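(* Let $A$ be a Hopf $\ast$-$(\Gamma,\omega)$-algebra. If $V$ and $W$ are unitarisable $\Gamma$-graded $A$-modules, then the tensor product $V\otimes_{\mathbb C}W$, with $A$ acting through its co-multiplication, is a unitarisable $\Gamma$-graded $A$-module. (Hence tensor products of unitarisable $\Gamma$-graded $A$-modules are unitarisable $\Gamma$-graded $A$-modules.)
   Context: All vector spaces are over $\mathbb C$. $\Gamma$ is an additive abelian group with a commutative factor $\omega:\Gamma\times\Gamma\to\mathbb C^*$, i.e. $\omega(\alpha,\beta)=\omega(\beta,\alpha)^{-1}$ and $\omega$ is multiplicative in each argument. Standing assumption: $\omega$ has the unit modulus property, $|\omega(\alpha,\beta)|=1$ for all $\alpha,\beta$. $d(x)$ is the degree of a homogeneous element; formulas with $d$ are extended linearly. An associative $(\Gamma,\omega)$-algebra is a $\Gamma$-graded unital associative algebra. The tensor product $A\otimes B$ has multiplication $(a\otimes b)(a'\otimes b')=\omega(d(b),d(a'))aa'\otimes bb'$. Homomorphisms are algebra homomorphisms of degree $0$. A $\ast$-structure on $A$ is a conjugate-linear involution $x\mapsto x^+$ with $(A_\alpha)^+=A_{-\alpha}$ and $(xy)^+=y^+x^+$. If $A,B$ have $\ast$-structures, $A\otimes B$ has the $\ast$-structure $(x\otimes y)^+=\omega(d(y),d(x))\,x^+\otimes y^+$. A Hopf $(\Gamma,\omega)$-algebra $(A,\mu;\Delta,\varepsilon,S)$: $\Delta:A\to A\otimes A$ and $\varepsilon:A\to\mathbb C$ are $(\Gamma,\omega)$-algebra homomorphisms which are coassociative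 and counital; the antipode $S$ is of degree $0$, satisfies $S(xy)=\omega(d(x),d(y))S(y)S(x)$ and $\mu(S\otimes\mathrm{id})\Delta=\mu(\mathrm{id}\otimes S)\Delta=\varepsilon(\cdot)1$. A Hopf $\ast$-$(\Gamma,\omega)$-algebra is a Hopf $(\Gamma,\omega)$-algebra such that $S$ is bijective and there is a group-like $K\in A$ ($\Delta(K)=K\otimes K$, $\varepsilon(K)=1$) with $S^2(x)=K^2xK^{-2}$ for all $x$, together with a $\ast$-structure on the algebra $A$ such that $\Delta(x^+)=\Delta(x)^+$, $\varepsilon(x^+)=\overline{\varepsilon(x)}$, and $K^+=K$. A $\Gamma$-graded $A$-module $V=\bigoplus V_\alpha$ ($A_\alpha V_\beta\subset V_{\alpha+\beta}$) is a unitarisable $\Gamma$-graded module if there is a positive definite sesquilinear form $\langle\ ,\ \rangle$ on $V$ (conjugate-linear in the first argument) with $\langle xv,v'\rangle=\langle v,x^+v'\rangle$ for all $x\in A$, and $\langle V_\alpha,V_\beta\rangle=0$ for $\alpha\ne\beta$. $A\otimes A$ acts on $V\otimes W$ by $(a\otimes b)(v\otimes w)=\omega(d(b),d(v))av\otimes bw$, and $A$ acts via $\Delta$. *)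

theory Defs
  imports Complex_Main "HOL-Library.Poly_Mapping"
begin

section \<open>Complex vector spaces and unital algebras\<close>

class complex_vector = ab_group_add +
  fixes scaleC :: "complex \<Rightarrow> 'a \<Rightarrow> 'a" (infixr \<open>*\<^sub>C\<close> 75)
  assumes scaleC_add_right: "c *\<^sub>C (x + y) = c *\<^sub>C x + c *\<^sub>C y"
    and scaleC_add_left: "(c + d) *\<^sub>C x = c *\<^sub>C x + d *\<^sub>C x"
    and scaleC_scaleC: "c *\<^sub>C d *\<^sub>C x = (c * d) *\<^sub>C x"
    and scaleC_one: "1 *\<^sub>C x = x"

interpretation cvec: vector_space "scaleC :: complex \<Rightarrow> 'a \<Rightarrow> 'a::complex_vector"
  by standard (simp_all add: scaleC_add_right scaleC_add_left scaleC_scaleC scaleC_one)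

class complex_algebra_1 = complex_vector + ring_1 +
  assumes mult_scaleC_left: "(c *\<^sub>C x) * y = c *\<^sub>C (x * y)"
    and mult_scaleC_right: "x * (c *\<^sub>C y) = c *\<^sub>C (x * y)"

abbreviation clinear :: "('a::complex_vector \<Rightarrow> 'b::complex_vector) \<Rightarrow> bool"
  where "clinear \<equiv> Vector_Spaces.linear scaleC scaleC"

instantiation complex :: complex_algebra_1
begin

definition scaleC_complex :: "complex \<Rightarrow> complex \<Rightarrow> complex"
  where "scaleC_complex c z = c * z"

instance
  by standard (simp_all add: scaleC_complex_def algebra_simps)

end

instantiation poly_mapping :: (type, complex_vector) complex_vector
begin

definition scaleC_poly_mapping :: "complex \<Rightarrow> ('a \<Rightarrow>\<^sub>0 'b) \<Rightarrow> ('a \<Rightarrow>\<^sub>0 'b)"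
  where "scaleC_poly_mapping c p = Poly_Mapping.map (scaleC c) p"

lemma lookup_scaleC: "Poly_Mapping.lookup (c *\<^sub>C p) k = c *\<^sub>C Poly_Mapping.lookup p k" for p :: "'a \<Rightarrow>\<^sub>0 'b"
  by (simp add: scaleC_poly_mapping_def map.rep_eq when_def)

instance
  by standard
    (simp_all add: poly_mapping_eq_iff fun_eq_iff lookup_scaleC lookup_add
      scaleC_add_right scaleC_add_left scaleC_scaleC scaleC_one)

end

section \<open>Tensor products of complex vector spaces\<close>

text \<open>The quotient of the free complex vector space on pairs by the bilinearity relations.\<close>

inductive_set tensor_relators ::
    "('a::complex_vector \<times> 'b::complex_vector \<Rightarrow>\<^sub>0 complex) set"
  where
    relator_add_left: "Poly_Mapping.single (a + a', b) 1
      - (Poly_Mapping.single (a, b) 1 + Poly_Mapping.single (a', b) 1) \<in> tensor_relators"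
  | relator_add_right: "Poly_Mapping.single (a, b + b') 1
      - (Poly_Mapping.single (a, b) 1 + Poly_Mapping.single (a, b') 1) \<in> tensor_relators"
  | relator_scale_left: "Poly_Mapping.single (c *\<^sub>C a, b) 1
      - c *\<^sub>C Poly_Mapping.single (a, b) 1 \<in> tensor_relators"
  | relator_scale_right: "Poly_Mapping.single (a, c *\<^sub>C b) 1
      - c *\<^sub>C Poly_Mapping.single (a, b) 1 \<in> tensor_relators"

definition tensor_rel ::
    "('a::complex_vector \<times> 'b::complex_vector \<Rightarrow>\<^sub>0 complex) \<Rightarrow> ('a \<times> 'b \<Rightarrow>\<^sub>0 complex) \<Rightarrow> bool"
  where "tensor_rel p q \<longleftrightarrow> p - q \<in> cvec.span tensor_relators"

lemma equivp_tensor_rel: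
  "equivp (tensor_rel :: ('a::complex_vector \<times> 'b::complex_vector \<Rightarrow>\<^sub>0 complex) \<Rightarrow> _)"
proof (rule equivpI)
  show "reflp (tensor_rel :: ('a \<times> 'b \<Rightarrow>\<^sub>0 complex) \<Rightarrow> _)"
    by (simp add: reflp_def tensor_rel_def cvec.span_zero)
  show "symp (tensor_rel :: ('a \<times> 'b \<Rightarrow>\<^sub>0 complex) \<Rightarrow> _)"
    unfolding symp_def tensor_rel_def by (metis cvec.span_neg minus_diff_eq)
  show "transp (tensor_rel :: ('a \<times> 'b \<Rightarrow>\<^sub>0 complex) \<Rightarrow> _)"
  proof (rule transpI, unfold tensor_rel_def)
    fix p q r :: "'a \<times> 'b \<Rightarrow>\<^sub>0 complex"
    assume "p - q \<in> cvec.span tensor_relators" "q - r \<in> cvec.span tensor_relators"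
    then have "(p - q) + (q - r) \<in> cvec.span tensor_relators" by (rule cvec.span_add)
    then show "p - r \<in> cvec.span tensor_relators" by simp
  qed
qed

quotient_type (overloaded) ('a, 'b) tensor =
    "'a::complex_vector \<times> 'b::complex_vector \<Rightarrow>\<^sub>0 complex" / tensor_rel
  by (rule equivp_tensor_rel)

instantiation tensor :: (complex_vector, complex_vector) complex_vector
begin

lift_definition zero_tensor :: "('a, 'b) tensor" is 0 .

lift_definition plus_tensor :: "('a, 'b) tensor \<Rightarrow> ('a, 'b) tensor \<Rightarrow> ('a, 'b) tensor" is "(+)"
  unfolding tensor_rel_def by (metis add_diff_add cvec.span_add)

lift_definition uminus_tensor :: "('a, 'b) tensor \<Rightarrow> ('a, 'b) tensor" is uminus
proof (unfold tensor_rel_def)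
  fix p q :: "'a \<times> 'b \<Rightarrow>\<^sub>0 complex"
  assume "p - q \<in> cvec.span tensor_relators"
  then have "- (p - q) \<in> cvec.span tensor_relators" by (rule cvec.span_neg)
  then show "- p - - q \<in> cvec.span tensor_relators" by simp
qed

lift_definition minus_tensor :: "('a, 'b) tensor \<Rightarrow> ('a, 'b) tensor \<Rightarrow> ('a, 'b) tensor" is "(-)"
proof (unfold tensor_rel_def)
  fix p p' q q' :: "'a \<times> 'b \<Rightarrow>\<^sub>0 complex"
  assume "p - p' \<in> cvec.span tensor_relators" "q - q' \<in> cvec.span tensor_relators"
  then have "(p - p') - (q - q') \<in> cvec.span tensor_relators" by (rule cvec.span_diff)
  then show "(p - q) - (p' - q') \<in> cvec.span tensor_relators" by (simp add: algebra_simps)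
qed

lift_definition scaleC_tensor :: "complex \<Rightarrow> ('a, 'b) tensor \<Rightarrow> ('a, 'b) tensor" is scaleC
  unfolding tensor_rel_def
  by (simp add: cvec.scale_right_diff_distrib[symmetric] cvec.span_scale)

instance
proof
qed (transfer; simp add: tensor_rel_def cvec.span_zero ac_simps
      scaleC_add_right scaleC_add_left scaleC_scaleC scaleC_one)+

end

lift_definition pure_tensor ::
    "'a::complex_vector \<Rightarrow> 'b::complex_vector \<Rightarrow> ('a, 'b) tensor" (infixr \<open>\<otimes>\<^sub>t\<close> 72)
  is "\<lambda>a b. Poly_Mapping.single (a, b) 1" .

lemma pure_tensor_add_left: "(a + a') \<otimes>\<^sub>t b = a \<otimes>\<^sub>t b + a' \<otimes>\<^sub>t b"
  by transfer (unfold tensor_rel_def, rule cvec.span_base[OF relator_add_left])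

lemma pure_tensor_add_right: "a \<otimes>\<^sub>t (b + b') = a \<otimes>\<^sub>t b + a \<otimes>\<^sub>t b'"
  by transfer (unfold tensor_rel_def, rule cvec.span_base[OF relator_add_right])

lemma pure_tensor_scaleC_left: "(c *\<^sub>C a) \<otimes>\<^sub>t b = c *\<^sub>C (a \<otimes>\<^sub>t b)"
  by transfer (unfold tensor_rel_def, rule cvec.span_base[OF relator_scale_left])

lemma pure_tensor_scaleC_right: "a \<otimes>\<^sub>t (c *\<^sub>C b) = c *\<^sub>C (a \<otimes>\<^sub>t b)"
  by transfer (unfold tensor_rel_def, rule cvec.span_base[OF relator_scale_right])

lemma scaleC_single: "c *\<^sub>C Poly_Mapping.single k d = Poly_Mapping.single k (c *\<^sub>C d)"
  by (simp add: poly_mapping_eq_iff fun_eq_iff lookup_scaleC lookup_single when_def)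

lemma tensor_induct [case_names pure add]:
  assumes pure: "\<And>a b. P (a \<otimes>\<^sub>t b)" and add: "\<And>t u. P t \<Longrightarrow> P u \<Longrightarrow> P (t + u)"
  shows "P t"
proof -
  have single: "P (abs_tensor (Poly_Mapping.single k c))" for k c
  proof -
    have "abs_tensor (Poly_Mapping.single k c) = c *\<^sub>C (fst k \<otimes>\<^sub>t snd k)"
      by (simp add: pure_tensor.abs_eq scaleC_tensor.abs_eq scaleC_single scaleC_complex_def)
    also have "\<dots> = (c *\<^sub>C fst k) \<otimes>\<^sub>t snd k" by (simp add: pure_tensor_scaleC_left)
    finally show ?thesis using pure by simp
  qed
  have "P (abs_tensor p)" for p
  proof (induction p rule: update_induct)
    case const
    show ?case using single[of undefined 0] by simp
  next
    case (update p k c)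
    have "Poly_Mapping.update k c p = p + Poly_Mapping.single k c"
      using update.hyps
      by (auto simp: poly_mapping_eq_iff fun_eq_iff lookup_update lookup_add lookup_single
          when_def in_keys_iff)
    then show ?case using add[OF update.IH single[of k c]] by (simp add: plus_tensor.abs_eq)
  qed
  then show ?thesis by (metis Quotient_abs_rep Quotient_tensor)
qed

text \<open>The extension is required to be additive only, so that it covers conjugate-linear maps
  as well; it exists and is unique for every balanced biadditive map.\<close>

definition tensor_lift ::
    "('a::complex_vector \<Rightarrow> 'b::complex_vector \<Rightarrow> 'c::ab_group_add) \<Rightarrow> ('a, 'b) tensor \<Rightarrow> 'c"
  where "tensor_lift f = (THE g. additive g \<and> (\<forall>a b. g (a \<otimes>\<^sub>t b) = f a b))"

locale balanced =
  fixes f :: "'a::complex_vector \<Rightarrow> 'b::complex_vector \<Rightarrow> 'c::ab_group_add"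
  assumes add_left: "f (a + a') b = f a b + f a' b"
    and add_right: "f a (b + b') = f a b + f a b'"
    and scale_swap: "f (c *\<^sub>C a) b = f a (c *\<^sub>C b)"
begin

definition free_lift :: "('a \<times> 'b \<Rightarrow>\<^sub>0 complex) \<Rightarrow> 'c"
  where "free_lift p = (\<Sum>k\<in>Poly_Mapping.keys p. f (Poly_Mapping.lookup p k *\<^sub>C fst k) (snd k))"

lemma zero_left: "f 0 b = 0"
  using add_left[of 0 0 b] by simp

lemma free_lift_add: "free_lift (p + q) = free_lift p + free_lift q"
  unfolding free_lift_def
  by (rule setsum_keys_plus_distrib) (simp_all add: zero_left cvec.scale_left_distrib add_left)

lemma free_lift_single: "free_lift (Poly_Mapping.single k c) = f (c *\<^sub>C fst k) (snd k)"
  by (simp add: free_lift_def zero_left)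

lemma free_lift_diff: "free_lift (p - q) = free_lift p - free_lift q"
  using free_lift_add[of "p - q" q] by simp

lemma free_lift_scaled_relator:
  assumes "r \<in> tensor_relators"
  shows "free_lift (d *\<^sub>C r) = 0"
proof -
  have scaled: "d *\<^sub>C Poly_Mapping.single k c = Poly_Mapping.single k (d * c)"
    for k :: "'a \<times> 'b" and c d :: complex
    by (simp add: scaleC_single scaleC_complex_def)
  have swap: "f (d *\<^sub>C a) (c *\<^sub>C b) = f ((d * c) *\<^sub>C a) b" for a b and c d :: complex
    using scale_swap[of c "d *\<^sub>C a" b] by (simp add: scaleC_scaleC mult.commute[of c])
  show ?thesis
    using assms
    by cases (simp_all add: cvec.scale_right_diff_distrib cvec.scale_right_distrib scaled
      free_lift_diff free_lift_add free_lift_single add_left add_right swap)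
qed

lemma free_lift_span:
  assumes "r \<in> cvec.span tensor_relators"
  shows "free_lift r = 0"
  using assms
proof (induction rule: cvec.span_induct_alt)
  case base
  show ?case by (simp add: free_lift_def)
next
  case (step c x y)
  then show ?case by (simp add: free_lift_add free_lift_scaled_relator)
qed

lemma tensor_lift_exists: "\<exists>g. additive g \<and> (\<forall>a b. g (a \<otimes>\<^sub>t b) = f a b)"
proof -
  have rep: "free_lift (rep_tensor (abs_tensor p)) = free_lift p" for p
  proof -
    have "tensor_rel (rep_tensor (abs_tensor p)) p"
      using Quotient_rep_abs[OF Quotient_tensor] equivp_reflp[OF equivp_tensor_rel] by blast
    then have "free_lift (rep_tensor (abs_tensor p) - p) = 0"
      unfolding tensor_rel_def by (rule free_lift_span)
    then show ?thesis by (simp add: free_lift_diff)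
  qed
  define g where "g t = free_lift (rep_tensor t)" for t
  have "g (a \<otimes>\<^sub>t b) = f a b" for a b
    by (simp add: g_def pure_tensor.abs_eq rep free_lift_single)
  moreover have "g (t + u) = g t + g u" for t u
  proof -
    have "t + u = abs_tensor (rep_tensor t + rep_tensor u)"
      by (metis Quotient_abs_rep Quotient_tensor plus_tensor.abs_eq)
    then show ?thesis by (simp add: g_def rep free_lift_add)
  qed
  ultimately show ?thesis by (auto simp: additive_def)
qed

lemma tensor_lift: "additive (tensor_lift f) \<and> (\<forall>a b. tensor_lift f (a \<otimes>\<^sub>t b) = f a b)"
proof -
  have "\<exists>!g. additive g \<and> (\<forall>a b. g (a \<otimes>\<^sub>t b) = f a b)"
  proof (rule ex_ex1I[OF tensor_lift_exists])
    fix g h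
    assume g: "additive g \<and> (\<forall>a b. g (a \<otimes>\<^sub>t b) = f a b)"
      and h: "additive h \<and> (\<forall>a b. h (a \<otimes>\<^sub>t b) = f a b)"
    have "g t = h t" for t
      by (induction t rule: tensor_induct) (use g h in \<open>auto simp: additive_def\<close>)
    then show "g = h" ..
  qed
  then show ?thesis unfolding tensor_lift_def by (rule theI')
qed

lemma tensor_lift_pure: "tensor_lift f (a \<otimes>\<^sub>t b) = f a b"
  using tensor_lift by blast

lemma tensor_lift_add: "tensor_lift f (t + u) = tensor_lift f t + tensor_lift f u"
  using tensor_lift by (simp add: additive_def)

end

definition tensor_map ::
    "('a::complex_vector \<Rightarrow> 'c::complex_vector) \<Rightarrow> ('b::complex_vector \<Rightarrow> 'd::complex_vector)
      \<Rightarrow> ('a, 'b) tensor \<Rightarrow> ('c, 'd) tensor"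
  where "tensor_map f g = tensor_lift (\<lambda>a b. f a \<otimes>\<^sub>t g b)"

definition tensor_assoc ::
    "(('a::complex_vector, 'b::complex_vector) tensor, 'c::complex_vector) tensor
      \<Rightarrow> ('a, ('b, 'c) tensor) tensor"
  where "tensor_assoc = tensor_lift (\<lambda>t c. tensor_lift (\<lambda>a b. a \<otimes>\<^sub>t (b \<otimes>\<^sub>t c)) t)"

section \<open>Gradings and commutative factors\<close>

definition homogeneous_decomposition ::
    "('g \<Rightarrow> 'a::complex_vector set) \<Rightarrow> 'a \<Rightarrow> ('g \<Rightarrow> 'a) \<Rightarrow> bool"
  where "homogeneous_decomposition G x c \<longleftrightarrow>
    (\<forall>\<alpha>. c \<alpha> \<in> G \<alpha>) \<and> finite {\<alpha>. c \<alpha> \<noteq> 0} \<and> x = (\<Sum>\<alpha> | c \<alpha> \<noteq> 0. c \<alpha>)"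

locale graded_space =
  fixes G :: "'g \<Rightarrow> 'a::complex_vector set"
  assumes subspace_grading: "cvec.subspace (G \<alpha>)"
    and direct_sum: "\<exists>!c. homogeneous_decomposition G x c"

definition homogeneous_components ::
    "('g \<Rightarrow> 'a::complex_vector set) \<Rightarrow> 'a \<Rightarrow> 'g \<Rightarrow> 'a"
  where "homogeneous_components G x = (THE c. homogeneous_decomposition G x c)"

locale commutative_factor =
  fixes \<omega> :: "'g::ab_group_add \<Rightarrow> 'g \<Rightarrow> complex"
  assumes factor_nonzero: "\<omega> \<alpha> \<beta> \<noteq> 0"
    and factor_swap: "\<omega> \<alpha> \<beta> = inverse (\<omega> \<beta> \<alpha>)"
    and factor_add_left: "\<omega> (\<alpha> + \<beta>) \<gamma> = \<omega> \<alpha> \<gamma> * \<omega> \<beta> \<gamma>"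
    and factor_add_right: "\<omega> \<alpha> (\<beta> + \<gamma>) = \<omega> \<alpha> \<beta> * \<omega> \<alpha> \<gamma>"

locale unit_modulus_factor = commutative_factor +
  assumes unit_modulus: "cmod (\<omega> \<alpha> \<beta>) = 1"

text \<open>The biadditive extension of the expression \<open>\<omega>(d(x), d(y)) h(x, y)\<close>, given for
  homogeneous \<open>x\<close> and \<open>y\<close>, to arbitrary arguments.\<close>

definition twisted ::
    "('g \<Rightarrow> 'g \<Rightarrow> complex) \<Rightarrow> ('g \<Rightarrow> 'a::complex_vector set) \<Rightarrow> ('g \<Rightarrow> 'b::complex_vector set)
      \<Rightarrow> ('a \<Rightarrow> 'b \<Rightarrow> 'c::complex_vector) \<Rightarrow> 'a \<Rightarrow> 'b \<Rightarrow> 'c"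
  where "twisted \<omega> G H h x y =
    (\<Sum>\<alpha> | homogeneous_components G x \<alpha> \<noteq> 0. \<Sum>\<beta> | homogeneous_components H y \<beta> \<noteq> 0.
      \<omega> \<alpha> \<beta> *\<^sub>C h (homogeneous_components G x \<alpha>) (homogeneous_components H y \<beta>))"

context graded_space
begin

lemma decomposition: "homogeneous_decomposition G x (homogeneous_components G x)"
  unfolding homogeneous_components_def by (rule theI'[OF direct_sum])

lemma components_eqI: "homogeneous_decomposition G x c \<Longrightarrow> homogeneous_components G x = c"
  using direct_sum[of x] decomposition[of x] by blast

lemma finite_components: "finite {\<alpha>. homogeneous_components G x \<alpha> \<noteq> 0}"
  using decomposition[of x] unfolding homogeneous_decomposition_def by blast

lemma components_in: "homogeneous_components G x \<alpha> \<in> G \<alpha>"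
  using decomposition[of x] unfolding homogeneous_decomposition_def by blast

lemma sum_components:
  assumes "finite S" "{\<alpha>. homogeneous_components G x \<alpha> \<noteq> 0} \<subseteq> S"
  shows "sum (homogeneous_components G x) S = x"
proof -
  have "sum (homogeneous_components G x) S
      = sum (homogeneous_components G x) {\<alpha>. homogeneous_components G x \<alpha> \<noteq> 0}"
    using assms by (intro sum.mono_neutral_right) auto
  also have "\<dots> = x"
    using decomposition[of x] unfolding homogeneous_decomposition_def by (elim conjE) (rule sym)
  finally show ?thesis .
qed

lemma components_homogeneous:
  assumes "x \<in> G \<alpha>"
  shows "homogeneous_components G x = (\<lambda>\<beta>. if \<beta> = \<alpha> then x else 0)"
proof (rule components_eqI)
  have "{\<beta>. (if \<beta> = \<alpha> then x else 0) \<noteq> 0} = (if x = 0 then {} else {\<alpha>})" by auto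
  then show "homogeneous_decomposition G x (\<lambda>\<beta>. if \<beta> = \<alpha> then x else 0)"
    using assms
    by (simp add: homogeneous_decomposition_def cvec.subspace_0[OF subspace_grading])
qed

lemma components_add:
  "homogeneous_components G (x + y) \<alpha> = homogeneous_components G x \<alpha> + homogeneous_components G y \<alpha>"
proof -
  let ?c = "homogeneous_components G x" and ?d = "homogeneous_components G y"
  let ?S = "{\<alpha>. ?c \<alpha> \<noteq> 0} \<union> {\<alpha>. ?d \<alpha> \<noteq> 0}"
  have fin: "finite ?S" by (simp add: finite_components)
  have sub: "{\<alpha>. ?c \<alpha> + ?d \<alpha> \<noteq> 0} \<subseteq> ?S" by auto
  have "x + y = sum ?c ?S + sum ?d ?S"
    using sum_components[OF fin, of x] sum_components[OF fin, of y] by simp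
  also have "\<dots> = (\<Sum>\<alpha>\<in>?S. ?c \<alpha> + ?d \<alpha>)" by (rule sum.distrib[symmetric])
  also have "\<dots> = (\<Sum>\<alpha> | ?c \<alpha> + ?d \<alpha> \<noteq> 0. ?c \<alpha> + ?d \<alpha>)"
    using fin sub by (intro sum.mono_neutral_right) auto
  finally have "homogeneous_decomposition G (x + y) (\<lambda>\<alpha>. ?c \<alpha> + ?d \<alpha>)"
    using finite_subset[OF sub fin] unfolding homogeneous_decomposition_def
    by (intro conjI allI cvec.subspace_add[OF subspace_grading] components_in)
  then show ?thesis by (simp add: components_eqI)
qed

lemma components_scaleC:
  "homogeneous_components G (k *\<^sub>C x) \<alpha> = k *\<^sub>C homogeneous_components G x \<alpha>"
proof -
  let ?c = "homogeneous_components G x"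
  have sub: "{\<alpha>. k *\<^sub>C ?c \<alpha> \<noteq> 0} \<subseteq> {\<alpha>. ?c \<alpha> \<noteq> 0}" by auto
  have "k *\<^sub>C x = k *\<^sub>C (\<Sum>\<alpha> | ?c \<alpha> \<noteq> 0. ?c \<alpha>)"
    using sum_components[OF finite_components, of x] by simp
  also have "\<dots> = (\<Sum>\<alpha> | ?c \<alpha> \<noteq> 0. k *\<^sub>C ?c \<alpha>)" by (rule cvec.scale_sum_right)
  also have "\<dots> = (\<Sum>\<alpha> | k *\<^sub>C ?c \<alpha> \<noteq> 0. k *\<^sub>C ?c \<alpha>)"
    by (rule sum.mono_neutral_right[OF finite_components sub]) auto
  finally have "homogeneous_decomposition G (k *\<^sub>C x) (\<lambda>\<alpha>. k *\<^sub>C ?c \<alpha>)"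
    using finite_subset[OF sub finite_components] unfolding homogeneous_decomposition_def
    by (intro conjI allI cvec.subspace_scale[OF subspace_grading] components_in)
  then show ?thesis by (simp add: components_eqI)
qed

end

locale twisted_extension = left: graded_space G + right: graded_space H
  for G :: "'g \<Rightarrow> 'a::complex_vector set" and H :: "'g \<Rightarrow> 'b::complex_vector set" +
  fixes \<omega> :: "'g \<Rightarrow> 'g \<Rightarrow> complex" and h :: "'a \<Rightarrow> 'b \<Rightarrow> 'c::complex_vector"
  assumes h_add_left: "h (x + x') y = h x y + h x' y"
    and h_add_right: "h x (y + y') = h x y + h x y'"
begin

lemma h_zero: "h 0 y = 0" "h x 0 = 0"
  using h_add_left[of 0 0 y] h_add_right[of x 0 0] by simp_all

lemma twisted_superset:
  assumes "finite S" "{\<alpha>. homogeneous_components G x \<alpha> \<noteq> 0} \<subseteq> S"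
    and "finite T" "{\<alpha>. homogeneous_components H y \<alpha> \<noteq> 0} \<subseteq> T"
  shows "twisted \<omega> G H h x y = (\<Sum>\<alpha>\<in>S. \<Sum>\<beta>\<in>T.
    \<omega> \<alpha> \<beta> *\<^sub>C h (homogeneous_components G x \<alpha>) (homogeneous_components H y \<beta>))"
  unfolding twisted_def
  by (rule sum.mono_neutral_cong_left[OF assms(1,2)])
    (auto simp: h_zero intro!: sum.mono_neutral_left assms(3,4) subsetD[OF assms(4)])

lemma twisted_homogeneous:
  assumes "x \<in> G \<alpha>" "y \<in> H \<beta>"
  shows "twisted \<omega> G H h x y = \<omega> \<alpha> \<beta> *\<^sub>C h x y"
proof -
  have "{\<gamma>. homogeneous_components G x \<gamma> \<noteq> 0} \<subseteq> {\<alpha>}"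
    "{\<gamma>. homogeneous_components H y \<gamma> \<noteq> 0} \<subseteq> {\<beta>}"
    using assms by (auto simp: left.components_homogeneous right.components_homogeneous)
  then have "twisted \<omega> G H h x y = (\<Sum>\<alpha>'\<in>{\<alpha>}. \<Sum>\<beta>'\<in>{\<beta>}.
      \<omega> \<alpha>' \<beta>' *\<^sub>C h (homogeneous_components G x \<alpha>') (homogeneous_components H y \<beta>'))"
    by (intro twisted_superset) simp_all
  also have "\<dots> = \<omega> \<alpha> \<beta> *\<^sub>C h x y"
    using left.components_homogeneous[OF assms(1)] right.components_homogeneous[OF assms(2)]
    by simp
  finally show ?thesis .
qed

lemma twisted_add_left: "twisted \<omega> G H h (x + x') y = twisted \<omega> G H h x y + twisted \<omega> G H h x' y"
proof -
  let ?S = "{\<alpha>. homogeneous_components G x \<alpha> \<noteq> 0} \<union> {\<alpha>. homogeneous_components G x' \<alpha> \<noteq> 0}"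
  let ?T = "{\<alpha>. homogeneous_components H y \<alpha> \<noteq> 0}"
  have "twisted \<omega> G H h z y = (\<Sum>\<alpha>\<in>?S. \<Sum>\<beta>\<in>?T.
      \<omega> \<alpha> \<beta> *\<^sub>C h (homogeneous_components G z \<alpha>) (homogeneous_components H y \<beta>))"
    if "z \<in> {x, x', x + x'}" for z
    using that
    by (intro twisted_superset)
      (auto simp: left.finite_components right.finite_components left.components_add)
  then show ?thesis
    by (simp add: left.components_add h_add_left scaleC_add_right sum.distrib)
qed

lemma twisted_add_right: "twisted \<omega> G H h x (y + y') = twisted \<omega> G H h x y + twisted \<omega> G H h x y'"
proof -
  let ?S = "{\<alpha>. homogeneous_components G x \<alpha> \<noteq> 0}"
  let ?T = "{\<alpha>. homogeneous_components H y \<alpha> \<noteq> 0} \<union> {\<alpha>. homogeneous_components H y' \<alpha> \<noteq> 0}"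
  have "twisted \<omega> G H h x z = (\<Sum>\<alpha>\<in>?S. \<Sum>\<beta>\<in>?T.
      \<omega> \<alpha> \<beta> *\<^sub>C h (homogeneous_components G x \<alpha>) (homogeneous_components H z \<beta>))"
    if "z \<in> {y, y', y + y'}" for z
    using that
    by (intro twisted_superset)
      (auto simp: left.finite_components right.finite_components right.components_add)
  then show ?thesis
    by (simp add: right.components_add h_add_right scaleC_add_right sum.distrib)
qed

lemma twisted_scale_left:
  assumes "\<And>x y. h (k *\<^sub>C x) y = l *\<^sub>C h x y"
  shows "twisted \<omega> G H h (k *\<^sub>C x) y = l *\<^sub>C twisted \<omega> G H h x y"
proof -
  have "twisted \<omega> G H h (k *\<^sub>C x) y = (\<Sum>\<alpha> | homogeneous_components G x \<alpha> \<noteq> 0.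
    \<Sum>\<beta> | homogeneous_components H y \<beta> \<noteq> 0.
    \<omega> \<alpha> \<beta> *\<^sub>C h (homogeneous_components G (k *\<^sub>C x) \<alpha>) (homogeneous_components H y \<beta>))"
    by (rule twisted_superset)
      (auto simp: left.finite_components right.finite_components left.components_scaleC)
  also have "\<dots> = l *\<^sub>C twisted \<omega> G H h x y"
    by (simp add: twisted_def left.components_scaleC assms cvec.scale_sum_right mult.commute)
  finally show ?thesis .
qed

lemma twisted_scale_right:
  assumes "\<And>x y. h x (k *\<^sub>C y) = l *\<^sub>C h x y"
  shows "twisted \<omega> G H h x (k *\<^sub>C y) = l *\<^sub>C twisted \<omega> G H h x y"
proof -
  have "twisted \<omega> G H h x (k *\<^sub>C y) = (\<Sum>\<alpha> | homogeneous_components G x \<alpha> \<noteq> 0.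
    \<Sum>\<beta> | homogeneous_components H y \<beta> \<noteq> 0.
    \<omega> \<alpha> \<beta> *\<^sub>C h (homogeneous_components G x \<alpha>) (homogeneous_components H (k *\<^sub>C y) \<beta>))"
    by (rule twisted_superset)
      (auto simp: left.finite_components right.finite_components right.components_scaleC)
  also have "\<dots> = l *\<^sub>C twisted \<omega> G H h x y"
    by (simp add: twisted_def right.components_scaleC assms cvec.scale_sum_right mult.commute)
  finally show ?thesis .
qed

end

definition tensor_grading ::
    "('g::ab_group_add \<Rightarrow> 'a::complex_vector set) \<Rightarrow> ('g \<Rightarrow> 'b::complex_vector set)
      \<Rightarrow> 'g \<Rightarrow> ('a, 'b) tensor set"
  where "tensor_grading G H \<gamma> =
    cvec.span {a \<otimes>\<^sub>t b | a b. \<exists>\<alpha> \<beta>. a \<in> G \<alpha> \<and> b \<in> H \<beta> \<and> \<alpha> + \<beta> = \<gamma>}"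

definition trivial_grading :: "'g::zero \<Rightarrow> complex set"
  where "trivial_grading \<alpha> = (if \<alpha> = 0 then UNIV else {0})"

text \<open>\<open>(a \<otimes> b)(a' \<otimes> b') = \<omega>(d(b), d(a')) aa' \<otimes> bb'\<close>\<close>

definition tensor_mult ::
    "('g \<Rightarrow> 'g \<Rightarrow> complex) \<Rightarrow> ('g \<Rightarrow> 'a::complex_algebra_1 set) \<Rightarrow> ('g \<Rightarrow> 'b::complex_algebra_1 set)
      \<Rightarrow> ('a, 'b) tensor \<Rightarrow> ('a, 'b) tensor \<Rightarrow> ('a, 'b) tensor"
  where "tensor_mult \<omega> GA GB t u =
    tensor_lift (\<lambda>a b. tensor_lift (\<lambda>a' b'.
      twisted \<omega> GB GA (\<lambda>b a'. (a * a') \<otimes>\<^sub>t (b * b')) b a') u) t"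

text \<open>\<open>(a \<otimes> b)\<^sup>+ = \<omega>(d(b), d(a)) a\<^sup>+ \<otimes> b\<^sup>+\<close>\<close>

definition tensor_star ::
    "('g \<Rightarrow> 'g \<Rightarrow> complex) \<Rightarrow> ('g \<Rightarrow> 'a::complex_vector set) \<Rightarrow> ('g \<Rightarrow> 'b::complex_vector set)
      \<Rightarrow> ('a \<Rightarrow> 'a) \<Rightarrow> ('b \<Rightarrow> 'b) \<Rightarrow> ('a, 'b) tensor \<Rightarrow> ('a, 'b) tensor"
  where "tensor_star \<omega> GA GB starA starB =
    tensor_lift (\<lambda>a b. twisted \<omega> GB GA (\<lambda>b a. starA a \<otimes>\<^sub>t starB b) b a)"

text \<open>\<open>(a \<otimes> b)(v \<otimes> w) = \<omega>(d(b), d(v)) av \<otimes> bw\<close>\<close>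

definition tensor_action ::
    "('g \<Rightarrow> 'g \<Rightarrow> complex) \<Rightarrow> ('g \<Rightarrow> 'b::complex_vector set) \<Rightarrow> ('g \<Rightarrow> 'v::complex_vector set)
      \<Rightarrow> ('a::complex_vector \<Rightarrow> 'v \<Rightarrow> 'v) \<Rightarrow> ('b \<Rightarrow> 'w::complex_vector \<Rightarrow> 'w)
      \<Rightarrow> ('a, 'b) tensor \<Rightarrow> ('v, 'w) tensor \<Rightarrow> ('v, 'w) tensor"
  where "tensor_action \<omega> GB GV actV actW t u =
    tensor_lift (\<lambda>a b. tensor_lift (\<lambda>v w.
      twisted \<omega> GB GV (\<lambda>b v. actV a v \<otimes>\<^sub>t actW b w) b v) u) t"

locale tensor_action_data = algebra: graded_space GB + space: graded_space GV
  for GB :: "'g \<Rightarrow> 'b::complex_vector set" and GV :: "'g \<Rightarrow> 'v::complex_vector set" +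
  fixes \<omega> :: "'g \<Rightarrow> 'g \<Rightarrow> complex"
    and actV :: "'a::complex_vector \<Rightarrow> 'v \<Rightarrow> 'v" and actW :: "'b \<Rightarrow> 'w::complex_vector \<Rightarrow> 'w"
  assumes actV_add: "actV (a + a') v = actV a v + actV a' v" "actV a (v + v') = actV a v + actV a v'"
    and actV_scale: "actV (k *\<^sub>C a) v = k *\<^sub>C actV a v" "actV a (k *\<^sub>C v) = k *\<^sub>C actV a v"
    and actW_add: "actW (b + b') w = actW b w + actW b' w" "actW b (w + w') = actW b w + actW b w'"
    and actW_scale: "actW (k *\<^sub>C b) w = k *\<^sub>C actW b w" "actW b (k *\<^sub>C w) = k *\<^sub>C actW b w"
begin

abbreviation block :: "'a \<Rightarrow> 'b \<Rightarrow> 'v \<Rightarrow> 'w \<Rightarrow> ('v, 'w) tensor"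
  where "block a b v w \<equiv> twisted \<omega> GB GV (\<lambda>b v. actV a v \<otimes>\<^sub>t actW b w) b v"

lemma twisted_extension_block: "twisted_extension GB GV (\<lambda>b v. actV a v \<otimes>\<^sub>t actW b w)"
  by unfold_locales
    (simp_all add: actV_add actW_add pure_tensor_add_left pure_tensor_add_right)

lemma block_add:
  "block (a + a') b v w = block a b v w + block a' b v w"
  "block a (b + b') v w = block a b v w + block a b' v w"
  "block a b (v + v') w = block a b v w + block a b v' w"
  "block a b v (w + w') = block a b v w + block a b v w'"
     apply (simp add: twisted_def actV_add pure_tensor_add_left scaleC_add_right sum.distrib)
    apply (rule twisted_extension.twisted_add_left[OF twisted_extension_block])
   apply (rule twisted_extension.twisted_add_right[OF twisted_extension_block])
  apply (simp add: twisted_def actW_add pure_tensor_add_right scaleC_add_right sum.distrib)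
  done

lemma block_scale:
  "block (k *\<^sub>C a) b v w = k *\<^sub>C block a b v w"
  "block a (k *\<^sub>C b) v w = k *\<^sub>C block a b v w"
  "block a b (k *\<^sub>C v) w = k *\<^sub>C block a b v w"
  "block a b v (k *\<^sub>C w) = k *\<^sub>C block a b v w"
     apply (simp add: twisted_def actV_scale pure_tensor_scaleC_left cvec.scale_sum_right mult.commute)
    apply (rule twisted_extension.twisted_scale_left[OF twisted_extension_block])
    apply (simp add: actW_scale pure_tensor_scaleC_right)
   apply (rule twisted_extension.twisted_scale_right[OF twisted_extension_block])
   apply (simp add: actV_scale pure_tensor_scaleC_left)
  apply (simp add: twisted_def actW_scale pure_tensor_scaleC_right cvec.scale_sum_right mult.commute)
  done

lemma balanced_inner: "balanced (block a b)"
  by unfold_locales (simp_all only: block_add block_scale)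

lemmas inner_pure = balanced.tensor_lift_pure[OF balanced_inner]
lemmas inner_add = balanced.tensor_lift_add[OF balanced_inner]

lemma balanced_outer: "balanced (\<lambda>a b. tensor_lift (block a b) u)"
proof
  fix a a' b b' k
  show "tensor_lift (block (a + a') b) u = tensor_lift (block a b) u + tensor_lift (block a' b) u"
  proof (induction u rule: tensor_induct)
    case (pure v w)
    show ?case unfolding inner_pure by (rule block_add)
  next
    case (add t u)
    show ?case unfolding inner_add add.IH by (simp only: ac_simps)
  qed
  show "tensor_lift (block a (b + b')) u = tensor_lift (block a b) u + tensor_lift (block a b') u"
  proof (induction u rule: tensor_induct)
    case (pure v w)
    show ?case unfolding inner_pure by (rule block_add)
  next
    case (add t u)
    show ?case unfolding inner_add add.IH by (simp only: ac_simps)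
  qed
  show "tensor_lift (block (k *\<^sub>C a) b) u = tensor_lift (block a (k *\<^sub>C b)) u"
  proof (induction u rule: tensor_induct)
    case (pure v w)
    show ?case unfolding inner_pure by (simp only: block_scale)
  next
    case (add t u)
    then show ?case unfolding inner_add by simp
  qed
qed

lemmas outer_pure = balanced.tensor_lift_pure[OF balanced_outer]
lemmas outer_add = balanced.tensor_lift_add[OF balanced_outer]

lemma tensor_action_pure:
  assumes "b \<in> GB \<beta>" "v \<in> GV \<alpha>"
  shows "tensor_action \<omega> GB GV actV actW (a \<otimes>\<^sub>t b) (v \<otimes>\<^sub>t w)
    = \<omega> \<beta> \<alpha> *\<^sub>C (actV a v \<otimes>\<^sub>t actW b w)"
  unfolding tensor_action_def outer_pure
  unfolding inner_pure
  by (rule twisted_extension.twisted_homogeneous[OF twisted_extension_block assms])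

lemma tensor_action_add:
  "tensor_action \<omega> GB GV actV actW (t + t') u
    = tensor_action \<omega> GB GV actV actW t u + tensor_action \<omega> GB GV actV actW t' u"
  "tensor_action \<omega> GB GV actV actW t (u + u')
    = tensor_action \<omega> GB GV actV actW t u + tensor_action \<omega> GB GV actV actW t u'"
proof -
  show "tensor_action \<omega> GB GV actV actW (t + t') u
    = tensor_action \<omega> GB GV actV actW t u + tensor_action \<omega> GB GV actV actW t' u" for t t'
    unfolding tensor_action_def by (rule outer_add)
  show "tensor_action \<omega> GB GV actV actW t (u + u')
    = tensor_action \<omega> GB GV actV actW t u + tensor_action \<omega> GB GV actV actW t u'"
    unfolding tensor_action_def
  proof (induction t rule: tensor_induct)
    case (pure a b)
    show ?case unfolding outer_pure by (rule inner_add)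
  next
    case (add t t')
    show ?case unfolding outer_add add.IH by (simp only: ac_simps)
  qed
qed

end

lemma tensor_mult_pure:
  fixes GA :: "'g \<Rightarrow> 'a::complex_algebra_1 set" and GB :: "'g \<Rightarrow> 'b::complex_algebra_1 set"
  assumes "graded_space GA" "graded_space GB" "b \<in> GB \<beta>" "a' \<in> GA \<alpha>"
  shows "tensor_mult \<omega> GA GB (a \<otimes>\<^sub>t b) (a' \<otimes>\<^sub>t b') = \<omega> \<beta> \<alpha> *\<^sub>C ((a * a') \<otimes>\<^sub>t (b * b'))"
proof -
  interpret tensor_action_data GB GA \<omega> "(*) :: 'a \<Rightarrow> _" "(*) :: 'b \<Rightarrow> _"
    using assms(1,2)
    by (intro tensor_action_data.intro tensor_action_data_axioms.intro)
      (simp_all add: algebra_simps mult_scaleC_left mult_scaleC_right)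
  show ?thesis
    using tensor_action_pure[OF assms(3,4)] by (simp add: tensor_mult_def tensor_action_def)
qed

section \<open>Graded algebras and Hopf algebras\<close>

text \<open>The condition \<open>one_degree\<close> is automatic for a unital algebra graded by a group.\<close>

locale graded_algebra = graded_space GA
  for GA :: "'g::ab_group_add \<Rightarrow> 'a::complex_algebra_1 set" +
  assumes one_degree: "1 \<in> GA 0"
    and mult_degree: "x \<in> GA \<alpha> \<Longrightarrow> y \<in> GA \<beta> \<Longrightarrow> x * y \<in> GA (\<alpha> + \<beta>)"

text \<open>Multiplication and unit are explicit arguments because the product of
  \<open>A \<otimes> B\<close> depends on \<open>\<omega>\<close> and on the gradings.\<close>

locale graded_algebra_hom =
  fixes G :: "'g \<Rightarrow> 'a::complex_vector set" and multG :: "'a \<Rightarrow> 'a \<Rightarrow> 'a" and oneG :: 'a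
    and H :: "'g \<Rightarrow> 'b::complex_vector set" and multH :: "'b \<Rightarrow> 'b \<Rightarrow> 'b" and oneH :: 'b
    and f :: "'a \<Rightarrow> 'b"
  assumes hom_linear: "clinear f"
    and hom_degree: "x \<in> G \<alpha> \<Longrightarrow> f x \<in> H \<alpha>"
    and hom_mult: "f (multG x y) = multH (f x) (f y)"
    and hom_one: "f oneG = oneH"

locale star_algebra = graded_algebra GA
  for GA :: "'g::ab_group_add \<Rightarrow> 'a::complex_algebra_1 set" +
  fixes star :: "'a \<Rightarrow> 'a"
  assumes star_add: "star (x + y) = star x + star y"
    and star_scaleC: "star (c *\<^sub>C x) = cnj c *\<^sub>C star x"
    and star_star: "star (star x) = x"
    and star_degree: "star ` GA \<alpha> = GA (- \<alpha>)"
    and star_mult: "star (x * y) = star y * star x"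

lemma tensor_star_pure:
  fixes \<omega> :: "'g::ab_group_add \<Rightarrow> 'g \<Rightarrow> complex"
  assumes "star_algebra GA starA" "star_algebra GB starB" "a \<in> GA \<alpha>" "b \<in> GB \<beta>"
  shows "tensor_star \<omega> GA GB starA starB (a \<otimes>\<^sub>t b) = \<omega> \<beta> \<alpha> *\<^sub>C (starA a \<otimes>\<^sub>t starB b)"
proof -
  interpret A: star_algebra GA starA by fact
  interpret B: star_algebra GB starB by fact
  interpret twisted_extension GB GA \<omega> "\<lambda>b a. starA a \<otimes>\<^sub>t starB b"
    by unfold_locales
      (simp_all add: A.star_add B.star_add pure_tensor_add_left pure_tensor_add_right)
  have scale: "starA a \<otimes>\<^sub>t starB (k *\<^sub>C b) = cnj k *\<^sub>C (starA a \<otimes>\<^sub>t starB b)"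
    "starA (k *\<^sub>C a) \<otimes>\<^sub>t starB b = cnj k *\<^sub>C (starA a \<otimes>\<^sub>t starB b)" for a b k
    by (simp_all add: A.star_scaleC B.star_scaleC pure_tensor_scaleC_left pure_tensor_scaleC_right)
  interpret balanced "\<lambda>a b. twisted \<omega> GB GA (\<lambda>b a. starA a \<otimes>\<^sub>t starB b) b a"
    by unfold_locales
      (simp_all only: twisted_add_left twisted_add_right
        twisted_scale_left[OF scale(1)] twisted_scale_right[OF scale(2)])
  show ?thesis
    unfolding tensor_star_def tensor_lift_pure by (rule twisted_homogeneous[OF assms(4,3)])
qed

locale hopf_algebra = commutative_factor \<omega> + graded_algebra GA +
    comult: graded_algebra_hom GA "(*)" 1 "tensor_grading GA GA" "tensor_mult \<omega> GA GA" "1 \<otimes>\<^sub>t 1" \<Delta> +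
    counit: graded_algebra_hom GA "(*)" 1 trivial_grading "(*)" 1 \<epsilon>
  for \<omega> :: "'g::ab_group_add \<Rightarrow> 'g \<Rightarrow> complex" and GA :: "'g \<Rightarrow> 'a::complex_algebra_1 set"
    and \<Delta> :: "'a \<Rightarrow> ('a, 'a) tensor" and \<epsilon> :: "'a \<Rightarrow> complex" +
  fixes S :: "'a \<Rightarrow> 'a"
  assumes coassociative: "tensor_assoc (tensor_map \<Delta> id (\<Delta> x)) = tensor_map id \<Delta> (\<Delta> x)"
    and counital_left: "tensor_lift (\<lambda>c a. c *\<^sub>C a) (tensor_map \<epsilon> id (\<Delta> x)) = x"
    and counital_right: "tensor_lift (\<lambda>a c. c *\<^sub>C a) (tensor_map id \<epsilon> (\<Delta> x)) = x"
    and antipode_linear: "clinear S"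
    and antipode_degree: "x \<in> GA \<alpha> \<Longrightarrow> S x \<in> GA \<alpha>"
    and antipode_mult: "x \<in> GA \<alpha> \<Longrightarrow> y \<in> GA \<beta> \<Longrightarrow> S (x * y) = \<omega> \<alpha> \<beta> *\<^sub>C (S y * S x)"
    and antipode_left: "tensor_lift (*) (tensor_map S id (\<Delta> x)) = \<epsilon> x *\<^sub>C 1"
    and antipode_right: "tensor_lift (*) (tensor_map id S (\<Delta> x)) = \<epsilon> x *\<^sub>C 1"

text \<open>The element \<open>K'\<close> below is the inverse of \<open>K\<close>.\<close>

locale hopf_star_algebra = hopf_algebra \<omega> GA \<Delta> \<epsilon> S + unit_modulus_factor \<omega> + star_algebra GA star
  for \<omega> :: "'g::ab_group_add \<Rightarrow> 'g \<Rightarrow> complex" and GA :: "'g \<Rightarrow> 'a::complex_algebra_1 set"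
    and \<Delta> :: "'a \<Rightarrow> ('a, 'a) tensor" and \<epsilon> :: "'a \<Rightarrow> complex" and S :: "'a \<Rightarrow> 'a"
    and star :: "'a \<Rightarrow> 'a" +
  assumes antipode_bij: "bij S"
    and group_like: "\<exists>K K'. \<Delta> K = K \<otimes>\<^sub>t K \<and> \<epsilon> K = 1 \<and> K * K' = 1 \<and> K' * K = 1 \<and>
      (\<forall>x. S (S x) = K ^ 2 * x * K' ^ 2) \<and> star K = K"
    and comult_star: "\<Delta> (star x) = tensor_star \<omega> GA GA star star (\<Delta> x)"
    and counit_star: "\<epsilon> (star x) = cnj (\<epsilon> x)"

section \<open>Graded modules and unitarisability\<close>

locale graded_module = graded_algebra GA + module_space: graded_space GV
  for GA :: "'g::ab_group_add \<Rightarrow> 'a::complex_algebra_1 set"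
    and GV :: "'g \<Rightarrow> 'v::complex_vector set" +
  fixes act :: "'a \<Rightarrow> 'v \<Rightarrow> 'v"
  assumes act_add_left: "act (x + y) v = act x v + act y v"
    and act_scaleC_left: "act (c *\<^sub>C x) v = c *\<^sub>C act x v"
    and act_linear: "clinear (act x)"
    and act_mult: "act (x * y) v = act x (act y v)"
    and act_one: "act 1 v = v"
    and act_degree: "x \<in> GA \<alpha> \<Longrightarrow> v \<in> GV \<beta> \<Longrightarrow> act x v \<in> GV (\<alpha> + \<beta>)"

definition sesquilinear :: "('v::complex_vector \<Rightarrow> 'v \<Rightarrow> complex) \<Rightarrow> bool"
  where "sesquilinear form \<longleftrightarrow>
    (\<forall>u v w. form (u + v) w = form u w + form v w) \<and>
    (\<forall>c v w. form (c *\<^sub>C v) w = cnj c * form v w) \<and>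
    (\<forall>v. clinear (form v))"

definition positive_definite :: "('v::complex_vector \<Rightarrow> 'v \<Rightarrow> complex) \<Rightarrow> bool"
  where "positive_definite form \<longleftrightarrow> (\<forall>v. v \<noteq> 0 \<longrightarrow> form v v \<in> \<real> \<and> Re (form v v) > 0)"

definition unitarisable_graded_module ::
    "('g::ab_group_add \<Rightarrow> 'a::complex_algebra_1 set) \<Rightarrow> ('a \<Rightarrow> 'a)
      \<Rightarrow> ('g \<Rightarrow> 'v::complex_vector set) \<Rightarrow> ('a \<Rightarrow> 'v \<Rightarrow> 'v) \<Rightarrow> bool"
  where "unitarisable_graded_module GA star GV act \<longleftrightarrow>
    graded_module GA GV act \<and>
    (\<exists>form. sesquilinear form \<and> positive_definite form \<and>
      (\<forall>x v v'. form (act x v) v' = form v (act (star x) v')) \<and>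
      (\<forall>\<alpha> \<beta>. \<forall>v\<in>GV \<alpha>. \<forall>v'\<in>GV \<beta>. \<alpha> \<noteq> \<beta> \<longrightarrow> form v v' = 0))"

end

theory Submission
  imports Defs
begin

text \<open>The form \<open>\<langle>v \<otimes> w, v' \<otimes> w'\<rangle> = \<langle>v, v'\<rangle>\<langle>w, w'\<rangle>\<close> works. For homogeneous
  \<open>a\<close>, \<open>b\<close>, \<open>v\<close>, \<open>v'\<close> both sides of the adjointness relation for \<open>a \<otimes> b\<close> vanish unless
  \<open>d(v') = d(a) + d(v)\<close>. In that case the left side carries the factor \<open>cnj \<omega>(d(b), d(v))\<close>, which is
  \<open>\<omega>(d(b), d(v))\<^sup>-\<^sup>1\<close> by the unit modulus property, and the right side the factor
  \<open>\<omega>(d(b), d(a)) \<omega>(-d(b), d(v'))\<close>, which has the same value. The form is positive definite because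
  every tensor can be written as \<open>\<Sum> e \<otimes> w\<^sub>e\<close> over a finite orthogonal family of vectors \<open>e\<close>,
  and orthogonality of the homogeneous parts shows that their sum is direct.\<close>

text \<open>The type class supplies the vector space axioms on both sides, so only additivity and
  homogeneity remain.\<close>

lemma clinear_iff:
  "clinear f \<longleftrightarrow> (\<forall>x y. f (x + y) = f x + f y) \<and> (\<forall>c x. f (c *\<^sub>C x) = c *\<^sub>C f x)"
  by (auto simp: Vector_Spaces.linear_def module_hom_iff cvec.vector_space_axioms cvec.module_axioms)

section \<open>Homogeneous tensors\<close>

lemma pure_tensor_zero: "0 \<otimes>\<^sub>t b = 0" "a \<otimes>\<^sub>t 0 = 0"
  using pure_tensor_scaleC_left[of 0 0 b] pure_tensor_scaleC_right[of a 0 0] by simp_all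

text \<open>The twisted products and actions have explicit formulas only on homogeneous vectors. A
  vector is the finite sum of its components, so biadditivity of the pure tensor splits first the
  right factor, then the left one.\<close>

lemma tensor_induct_homogeneous [consumes 2, case_names pure add]:
  assumes "graded_space G" "graded_space H"
    and pure: "\<And>\<alpha> \<beta> a b. a \<in> G \<alpha> \<Longrightarrow> b \<in> H \<beta> \<Longrightarrow> P (a \<otimes>\<^sub>t b)"
    and add: "\<And>t u. P t \<Longrightarrow> P u \<Longrightarrow> P (t + u)"
  shows "P t"
proof -
  interpret G: graded_space G by fact
  interpret H: graded_space H by fact
  have right: "P (a \<otimes>\<^sub>t sum (homogeneous_components H b) S)" if a: "a \<in> G \<alpha>" and "finite S" for a b \<alpha> S
    using \<open>finite S\<close>
  proof (induction S)
    case empty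
    \<comment> \<open>No case \<open>P 0\<close> is assumed; zero lies in every homogeneous
      subspace, so \<open>pure\<close> covers the empty sum.\<close>
    show ?case using pure[OF a cvec.subspace_0[OF H.subspace_grading]] by simp
  next
    case (insert \<beta> S)
    then show ?case using add[OF pure[OF a H.components_in]] by (simp add: pure_tensor_add_right)
  qed
  then have right: "P (a \<otimes>\<^sub>t b)" if "a \<in> G \<alpha>" for a b \<alpha>
    using that H.sum_components[OF H.finite_components order_refl] H.finite_components by metis
  have left: "P (sum (homogeneous_components G a) S \<otimes>\<^sub>t b)" if "finite S" for a b S
    using that
  proof (induction S)
    case empty
    show ?case using right[OF cvec.subspace_0[OF G.subspace_grading]] by simp
  next
    case (insert \<beta> S)
    then show ?case using add[OF right[OF G.components_in]] by (simp add: pure_tensor_add_left)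
  qed
  show ?thesis
  proof (induction t rule: tensor_induct)
    case (pure a b)
    show ?case
      using left[OF G.finite_components] G.sum_components[OF G.finite_components order_refl] by metis
  next
    case (add t u)
    then show ?case by (rule assms(4))
  qed
qed

section \<open>Homogeneous decompositions in a family of subspaces\<close>

text \<open>Stated outside \<open>graded_space\<close>: for the tensor grading, existence of
  decompositions is established before the sum is known to be direct.\<close>

lemma homogeneous_decomposition_single:
  assumes "\<And>\<beta>. cvec.subspace (G \<beta>)" "x \<in> G \<alpha>"
  shows "homogeneous_decomposition G x (\<lambda>\<beta>. if \<beta> = \<alpha> then x else 0)"
proof -
  have "{\<beta>. (if \<beta> = \<alpha> then x else 0) \<noteq> 0} = (if x = 0 then {} else {\<alpha>})" by auto
  then show ?thesis using assms by (simp add: homogeneous_decomposition_def cvec.subspace_0)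
qed

lemma homogeneous_decomposition_superset:
  assumes "homogeneous_decomposition G x c" "finite S" "{\<alpha>. c \<alpha> \<noteq> 0} \<subseteq> S"
  shows "x = sum c S"
  using assms by (auto simp: homogeneous_decomposition_def intro!: sum.mono_neutral_left)

lemma homogeneous_decomposition_add:
  assumes "\<And>\<beta>. cvec.subspace (G \<beta>)"
    and c: "homogeneous_decomposition G x c" and d: "homogeneous_decomposition G y d"
  shows "homogeneous_decomposition G (x + y) (\<lambda>\<alpha>. c \<alpha> + d \<alpha>)"
proof -
  let ?S = "{\<alpha>. c \<alpha> \<noteq> 0} \<union> {\<alpha>. d \<alpha> \<noteq> 0}"
  have fin: "finite ?S" using c d by (simp add: homogeneous_decomposition_def)
  have sub: "{\<alpha>. c \<alpha> + d \<alpha> \<noteq> 0} \<subseteq> ?S" by auto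
  have "x + y = (\<Sum>\<alpha>\<in>?S. c \<alpha> + d \<alpha>)"
    using homogeneous_decomposition_superset[OF c fin] homogeneous_decomposition_superset[OF d fin]
    by (simp add: sum.distrib)
  \<comment> \<open>Components may cancel, so the support can be smaller than
    \<open>?S\<close>.\<close>
  also have "\<dots> = (\<Sum>\<alpha> | c \<alpha> + d \<alpha> \<noteq> 0. c \<alpha> + d \<alpha>)"
    using fin sub by (intro sum.mono_neutral_right) auto
  finally show ?thesis
    using assms finite_subset[OF sub fin]
    by (simp add: homogeneous_decomposition_def cvec.subspace_add)
qed

section \<open>Positive definite sesquilinear forms\<close>

lemma sesquilinearD:
  assumes "sesquilinear f"
  shows "f (u + v) w = f u w + f v w" "f (c *\<^sub>C v) w = cnj c * f v w"
    "f v (u + w) = f v u + f v w" "f v (c *\<^sub>C w) = c * f v w"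
  using assms unfolding sesquilinear_def clinear_iff by (auto simp: scaleC_complex_def)

lemma sesquilinear_zero:
  assumes "sesquilinear f"
  shows "f 0 w = 0" "f v 0 = 0"
  using sesquilinearD(2)[OF assms, of 0] sesquilinearD(4)[OF assms, of _ 0] by simp_all

lemma sesquilinear_diff:
  assumes "sesquilinear f"
  shows "f v (u - w) = f v u - f v w"
  using sesquilinearD(3)[OF assms, of v "u - w" w] by simp

lemma sesquilinear_sum:
  assumes "sesquilinear f"
  shows "f (sum g A) w = (\<Sum>i\<in>A. f (g i) w)" "f v (sum g A) = (\<Sum>i\<in>A. f v (g i))"
  by (induction A rule: infinite_finite_induct; simp add: sesquilinear_zero[OF assms] sesquilinearD[OF assms])+

lemma positive_definite_nonzero:
  assumes "positive_definite f" "v \<noteq> 0"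
  shows "f v v \<noteq> 0"
  using assms by (force simp: positive_definite_def)

text \<open>Polarisation: all values \<open>f v v\<close> are real, and evaluating at
  \<open>x + y\<close> and at \<open>x + \<i> *\<^sub>C y\<close> yields the imaginary and the real
  part of the symmetry.\<close>

lemma positive_definite_hermitian:
  assumes f: "sesquilinear f" and pos: "positive_definite f"
  shows "f x y = cnj (f y x)"
proof -
  \<comment> \<open>Positivity speaks of nonzero \<open>v\<close> only; at zero the value comes from
    sesquilinearity.\<close>
  have real: "Im (f v v) = 0" for v
    using pos sesquilinear_zero[OF f, of v]
    by (cases "v = 0") (auto simp: positive_definite_def complex_is_Real_iff)
  have "Im (f x y + f y x) = 0"
    using real[of "x + y"] real[of x] real[of y] by (simp add: sesquilinearD[OF f])
  \<comment> \<open>The first argument is conjugate-linear, so the cross terms here are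
    \<open>\<i> * (f x y - f y x)\<close>.\<close>
  moreover have "Re (f x y) = Re (f y x)"
    using real[of "x + \<i> *\<^sub>C y"] real[of x] real[of y] by (simp add: sesquilinearD[OF f])
  ultimately show ?thesis by (simp add: complex_eq_iff)
qed

section \<open>Orthogonality and direct sums\<close>

text \<open>Two decompositions of \<open>x\<close> differ by a family of pairwise orthogonal vectors
  with sum zero, and a definite form forces each of them to vanish. This yields directness of the
  tensor grading without choosing bases.\<close>

lemma graded_space_orthogonal:
  assumes sub: "\<And>\<alpha>. cvec.subspace (G \<alpha>)"
    and f: "sesquilinear f" "positive_definite f"
    and orth: "\<And>\<alpha> \<beta> x y. x \<in> G \<alpha> \<Longrightarrow> y \<in> G \<beta> \<Longrightarrow> \<alpha> \<noteq> \<beta> \<Longrightarrow> f x y = 0"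
    and ex: "\<And>x. \<exists>c. homogeneous_decomposition G x c"
  shows "graded_space G"
proof
  fix x
  show "\<exists>!c. homogeneous_decomposition G x c"
  proof (rule ex_ex1I[OF ex])
    fix c d
    assume c: "homogeneous_decomposition G x c" and d: "homogeneous_decomposition G x d"
    let ?S = "{\<alpha>. c \<alpha> \<noteq> 0} \<union> {\<alpha>. d \<alpha> \<noteq> 0}"
    have fin: "finite ?S" using c d by (simp add: homogeneous_decomposition_def)
    have zero: "(\<Sum>\<beta>\<in>?S. c \<beta> - d \<beta>) = 0"
      using homogeneous_decomposition_superset[OF c fin] homogeneous_decomposition_superset[OF d fin]
      by (simp add: sum_subtractf)
    have mem: "c \<alpha> - d \<alpha> \<in> G \<alpha>" for \<alpha>
      using c d sub by (simp add: homogeneous_decomposition_def cvec.subspace_diff)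
    show "c = d"
    proof
      fix \<alpha>
      show "c \<alpha> = d \<alpha>"
      proof (cases "\<alpha> \<in> ?S")
        case True
        \<comment> \<open>Pairing the vanishing sum with its component of degree \<alpha> isolates
          that component's square.\<close>
        have "0 = (\<Sum>\<beta>\<in>?S. f (c \<alpha> - d \<alpha>) (c \<beta> - d \<beta>))"
          using sesquilinear_sum(2)[OF f(1)] zero sesquilinear_zero(2)[OF f(1)] by metis
        also have "\<dots> = (\<Sum>\<beta>\<in>?S. if \<beta> = \<alpha> then f (c \<alpha> - d \<alpha>) (c \<alpha> - d \<alpha>) else 0)"
          by (rule sum.cong) (auto intro: orth[OF mem mem])
        also have "\<dots> = f (c \<alpha> - d \<alpha>) (c \<alpha> - d \<alpha>)"
          using fin True by (simp add: sum.delta)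
        finally show ?thesis using positive_definite_nonzero[OF f(2), of "c \<alpha> - d \<alpha>"] by auto
      qed simp
    qed
  qed
qed (rule sub)

section \<open>The grading of a tensor product\<close>

lemma tensor_grading_pure: "a \<in> G \<alpha> \<Longrightarrow> b \<in> H \<beta> \<Longrightarrow> a \<otimes>\<^sub>t b \<in> tensor_grading G H (\<alpha> + \<beta>)"
  unfolding tensor_grading_def by (rule cvec.span_base) blast

lemma tensor_grading_induct [consumes 1, case_names pure zero add scale]:
  assumes "t \<in> tensor_grading G H \<gamma>"
    and pure: "\<And>\<alpha> \<beta> a b. a \<in> G \<alpha> \<Longrightarrow> b \<in> H \<beta> \<Longrightarrow> \<alpha> + \<beta> = \<gamma> \<Longrightarrow> P (a \<otimes>\<^sub>t b)"
    and "P 0" "\<And>t u. P t \<Longrightarrow> P u \<Longrightarrow> P (t + u)" "\<And>c t. P t \<Longrightarrow> P (c *\<^sub>C t)"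
  shows "P t"
  using assms(1) unfolding tensor_grading_def
  by (rule cvec.span_induct) (auto simp: cvec.subspace_def assms(3-) intro: pure)

lemma subspace_tensor_grading: "cvec.subspace (tensor_grading G H \<gamma>)"
  unfolding tensor_grading_def by (rule cvec.subspace_span)

text \<open>A tensor of homogeneous vectors sits in a single degree, and decompositions add.
  Uniqueness is left to orthogonality.\<close>

lemma tensor_grading_decomposition:
  assumes "graded_space G" "graded_space H"
  shows "\<exists>c. homogeneous_decomposition (tensor_grading G H) t c"
  using assms
proof (induction t rule: tensor_induct_homogeneous)
  case (pure \<alpha> \<beta> a b)
  then show ?case
    using homogeneous_decomposition_single[where G = "tensor_grading G H", OF subspace_tensor_grading
        tensor_grading_pure[of a G \<alpha> b H \<beta>]] by blast
next
  case (add t u)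
  then show ?case
    using homogeneous_decomposition_add[where G = "tensor_grading G H", OF subspace_tensor_grading]
    by blast
qed

section \<open>The product of two sesquilinear forms\<close>

text \<open>\<open>tensor_lift\<close> demands only a balanced biadditive map, so the outer lift may
  be conjugate-linear while the inner one is linear.\<close>

definition tensor_form ::
    "('v::complex_vector \<Rightarrow> 'v \<Rightarrow> complex) \<Rightarrow> ('w::complex_vector \<Rightarrow> 'w \<Rightarrow> complex)
      \<Rightarrow> ('v, 'w) tensor \<Rightarrow> ('v, 'w) tensor \<Rightarrow> complex"
  where "tensor_form f g t u = tensor_lift (\<lambda>v w. tensor_lift (\<lambda>v' w'. f v v' * g w w') u) t"

locale sesquilinear_pair =
  fixes f :: "'v::complex_vector \<Rightarrow> 'v \<Rightarrow> complex" and g :: "'w::complex_vector \<Rightarrow> 'w \<Rightarrow> complex"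
  assumes sesquilinear_left: "sesquilinear f" and sesquilinear_right: "sesquilinear g"
begin

lemmas f_simps = sesquilinearD[OF sesquilinear_left] and g_simps = sesquilinearD[OF sesquilinear_right]

lemma balanced_second: "balanced (\<lambda>v' w'. f v v' * g w w')"
  by unfold_locales (simp_all add: f_simps g_simps algebra_simps)

lemmas second_pure = balanced.tensor_lift_pure[OF balanced_second]
lemmas second_add = balanced.tensor_lift_add[OF balanced_second]

text \<open>The identities in \<open>v\<close> and \<open>w\<close> are checked by induction on
  \<open>u\<close>. A scalar may move between \<open>v\<close> and \<open>w\<close> because
  \<open>f\<close> and \<open>g\<close> both release it as \<open>cnj k\<close>.\<close>

lemma balanced_first: "balanced (\<lambda>v w. tensor_lift (\<lambda>v' w'. f v v' * g w w') u)"
proof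
  fix v v' w w' and k :: complex
  let ?F = "\<lambda>v w. tensor_lift (\<lambda>v' w'. f v v' * g w w')"
  show "?F (v + v') w u = ?F v w u + ?F v' w u"
  proof (induction u rule: tensor_induct)
    case (pure x y)
    show ?case unfolding second_pure by (simp add: f_simps algebra_simps)
  next
    case (add t u)
    then show ?case unfolding second_add by simp
  qed
  show "?F v (w + w') u = ?F v w u + ?F v w' u"
  proof (induction u rule: tensor_induct)
    case (pure x y)
    show ?case unfolding second_pure by (simp add: g_simps algebra_simps)
  next
    case (add t u)
    then show ?case unfolding second_add by simp
  qed
  show "?F (k *\<^sub>C v) w u = ?F v (k *\<^sub>C w) u"
  proof (induction u rule: tensor_induct)
    case (pure x y)
    show ?case unfolding second_pure by (simp add: f_simps g_simps algebra_simps)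
  next
    case (add t u)
    then show ?case unfolding second_add by simp
  qed
qed

lemma tensor_form_pure: "tensor_form f g (v \<otimes>\<^sub>t w) (v' \<otimes>\<^sub>t w') = f v v' * g w w'"
  unfolding tensor_form_def balanced.tensor_lift_pure[OF balanced_first] by (rule second_pure)

lemma tensor_form_add_left: "tensor_form f g (t + t') u = tensor_form f g t u + tensor_form f g t' u"
  unfolding tensor_form_def by (rule balanced.tensor_lift_add[OF balanced_first])

lemma tensor_form_add_right: "tensor_form f g t (u + u') = tensor_form f g t u + tensor_form f g t u'"
proof (induction t rule: tensor_induct)
  case (pure v w)
  show ?case unfolding tensor_form_def balanced.tensor_lift_pure[OF balanced_first] by (rule second_add)
next
  case (add t t')
  then show ?case by (simp add: tensor_form_add_left)
qed

text \<open>The lift is only known to be additive, so scalars need their own induction; on a pure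
  tensor the scalar is absorbed into the left factor.\<close>

lemma tensor_form_scale_left: "tensor_form f g (c *\<^sub>C t) u = cnj c * tensor_form f g t u"
proof (induction t rule: tensor_induct)
  case (pure v w)
  show ?case
    by (induction u rule: tensor_induct)
      (simp_all add: tensor_form_add_right tensor_form_pure f_simps algebra_simps
        flip: pure_tensor_scaleC_left)
next
  case (add t t')
  then show ?case by (simp add: tensor_form_add_left scaleC_add_right algebra_simps)
qed

lemma tensor_form_scale_right: "tensor_form f g t (c *\<^sub>C u) = c * tensor_form f g t u"
proof (induction t rule: tensor_induct)
  case (pure v w)
  show ?case
    by (induction u rule: tensor_induct)
      (simp_all add: tensor_form_add_right tensor_form_pure f_simps scaleC_add_right algebra_simps
        flip: pure_tensor_scaleC_left)
next
  case (add t t')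
  then show ?case by (simp add: tensor_form_add_left algebra_simps)
qed

lemma sesquilinear_tensor_form: "sesquilinear (tensor_form f g)"
  unfolding sesquilinear_def clinear_iff
  by (simp add: tensor_form_add_left tensor_form_add_right tensor_form_scale_left
      tensor_form_scale_right scaleC_complex_def)

section \<open>Orthogonal expansion and positive definiteness\<close>

text \<open>The step from \<open>t\<close> to \<open>t + v \<otimes> w\<close> is one step of Gram--Schmidt applied to \<open>v\<close>.\<close>

lemma orthogonal_expansion:
  assumes pos: "positive_definite f"
  shows "\<exists>E h. finite E \<and> 0 \<notin> E \<and> (\<forall>x\<in>E. \<forall>y\<in>E. x \<noteq> y \<longrightarrow> f x y = 0) \<and> t = (\<Sum>e\<in>E. e \<otimes>\<^sub>t h e)"
    (is "?P t")
proof -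
  have step: "?P (t + v \<otimes>\<^sub>t w)" if expansion: "?P t" for t v w
  proof -
    obtain E h where E: "finite E" "0 \<notin> E" "\<And>x y. x \<in> E \<Longrightarrow> y \<in> E \<Longrightarrow> x \<noteq> y \<Longrightarrow> f x y = 0"
      and t: "t = (\<Sum>e\<in>E. e \<otimes>\<^sub>t h e)"
      using expansion by blast
    \<comment> \<open>The coefficients of the orthogonal projection of \<open>v\<close> onto the
      span of \<open>E\<close>; \<open>e\<close> stands first because \<open>f\<close> is linear in
      its second argument.\<close>
    define c where "c e = f e v / f e e" for e
    define r where "r = v - (\<Sum>e\<in>E. c e *\<^sub>C e)"
    have nz: "f e e \<noteq> 0" if "e \<in> E" for e
      using positive_definite_nonzero[OF pos, of e] that E(2) by auto
    have er: "f e r = 0" if "e \<in> E" for e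
    proof -
      have "(\<Sum>e'\<in>E. f e (c e' *\<^sub>C e')) = (\<Sum>e'\<in>E. if e' = e then c e * f e e else 0)"
        by (rule sum.cong) (auto simp: f_simps E(3)[OF that])
      also have "\<dots> = f e v" using E(1) that nz[OF that] by (simp add: c_def)
      finally show ?thesis
        by (simp add: r_def sesquilinear_diff[OF sesquilinear_left] sesquilinear_sum[OF sesquilinear_left])
    qed
    \<comment> \<open>Orthogonality within \<open>E\<close> is required in both orders, and
      Hermitian symmetry supplies the second.\<close>
    have re: "f r e = 0" if "e \<in> E" for e
      using positive_definite_hermitian[OF sesquilinear_left pos, of r e] er[OF that] by simp
    have sum_pure: "(\<Sum>e\<in>A. c e *\<^sub>C e) \<otimes>\<^sub>t w = (\<Sum>e\<in>A. e \<otimes>\<^sub>t (c e *\<^sub>C w))" for A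
    proof (induction A rule: infinite_finite_induct)
      case (insert x A)
      then show ?case
        by (simp add: pure_tensor_add_left pure_tensor_scaleC_left pure_tensor_scaleC_right)
    qed (simp_all add: pure_tensor_zero)
    have v: "v = r + (\<Sum>e\<in>E. c e *\<^sub>C e)" by (simp add: r_def)
    \<comment> \<open>The projected part of \<open>v\<close> brings no new vectors: its coefficients
      slide across the tensor sign onto \<open>w\<close> and merge with \<open>h\<close>.\<close>
    have expand: "t + v \<otimes>\<^sub>t w = r \<otimes>\<^sub>t w + (\<Sum>e\<in>E. e \<otimes>\<^sub>t (h e + c e *\<^sub>C w))"
      by (subst v) (simp add: t pure_tensor_add_left pure_tensor_add_right sum_pure sum.distrib)
    show ?thesis
    proof (cases "r = 0")
      case True
      then have "t + v \<otimes>\<^sub>t w = (\<Sum>e\<in>E. e \<otimes>\<^sub>t (h e + c e *\<^sub>C w))"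
        using expand by (simp add: pure_tensor_zero)
      then show ?thesis using E by (intro exI[of _ E] exI[of _ "\<lambda>e. h e + c e *\<^sub>C w"]) simp
    next
      case False
      \<comment> \<open>\<open>r\<close> is orthogonal to all of \<open>E\<close> but not to
        itself.\<close>
      then have "r \<notin> E" using er positive_definite_nonzero[OF pos] by blast
      then have "t + v \<otimes>\<^sub>t w = (\<Sum>e\<in>insert r E. e \<otimes>\<^sub>t (if e = r then w else h e + c e *\<^sub>C w))"
        unfolding expand using E(1) by (simp, intro sum.cong) auto
      then show ?thesis
        using E er re False
        by (intro exI[of _ "insert r E"] exI[of _ "\<lambda>e. if e = r then w else h e + c e *\<^sub>C w"]) auto
    qed
  qed
  \<comment> \<open>\<open>tensor_induct\<close> has no zero case. Generalising over the tensor
    \<open>u\<close> already expanded lets summands be appended one at a time, starting from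
    zero.\<close>
  have extend: "?P u \<Longrightarrow> ?P (u + t)" for u
  proof (induction t arbitrary: u rule: tensor_induct)
    case (pure v w)
    then show ?case by (rule step)
  next
    case (add t t')
    show ?case using add.IH(2)[OF add.IH(1)[OF add.prems]] by (simp only: add.assoc)
  qed
  have "?P 0" by (intro exI[of _ "{}"]) simp
  from extend[OF this] show ?thesis by (simp only: add_0)
qed

text \<open>On an orthogonal expansion the form is the sum of \<open>f e e * g (h e) (h e)\<close>.
  Each term is real and nonnegative, and a nonzero tensor has some nonzero \<open>h e\<close>, whose
  term is positive.\<close>

lemma positive_definite_tensor_form:
  assumes "positive_definite f" "positive_definite g"
  shows "positive_definite (tensor_form f g)"
  unfolding positive_definite_def
proof (intro allI impI)
  fix t :: "('v, 'w) tensor"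
  assume "t \<noteq> 0"
  obtain E h where E: "finite E" "0 \<notin> E" "\<And>x y. x \<in> E \<Longrightarrow> y \<in> E \<Longrightarrow> x \<noteq> y \<Longrightarrow> f x y = 0"
    and t: "t = (\<Sum>e\<in>E. e \<otimes>\<^sub>t h e)"
    using orthogonal_expansion[OF assms(1), of t] by blast
  have diag: "tensor_form f g t t = (\<Sum>e\<in>E. f e e * g (h e) (h e))"
  proof -
    have "tensor_form f g t t = (\<Sum>e\<in>E. \<Sum>e'\<in>E. f e e' * g (h e) (h e'))"
      unfolding t sesquilinear_sum(1)[OF sesquilinear_tensor_form]
      unfolding sesquilinear_sum(2)[OF sesquilinear_tensor_form] tensor_form_pure ..
    \<comment> \<open>The off-diagonal terms vanish through \<open>f\<close>, whatever the vectors
      \<open>h e\<close> are.\<close>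
    also have "\<dots> = (\<Sum>e\<in>E. \<Sum>e'\<in>E. if e' = e then f e e * g (h e) (h e) else 0)"
      by (intro sum.cong refl) (use E(3) in auto)
    finally show ?thesis using E(1) by simp
  qed
  have "\<exists>e\<in>E. h e \<noteq> 0"
  proof (rule ccontr)
    assume "\<not> ?thesis"
    then have "t = 0" unfolding t by (intro sum.neutral) (simp add: pure_tensor_zero)
    then show False using \<open>t \<noteq> 0\<close> by simp
  qed
  then obtain e where e: "e \<in> E" "h e \<noteq> 0" by blast
  have val: "f x x * g y y \<in> \<real> \<and> Re (f x x * g y y) \<ge> 0 \<and> (y \<noteq> 0 \<longrightarrow> Re (f x x * g y y) > 0)"
    if "x \<in> E" for x y
  proof (cases "y = 0")
    case True
    then show ?thesis by (simp add: sesquilinear_zero[OF sesquilinear_right])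
  next
    case False
    have "x \<noteq> 0" using that E(2) by blast
    then have "f x x \<in> \<real>" "Re (f x x) > 0" "g y y \<in> \<real>" "Re (g y y) > 0"
      using assms False unfolding positive_definite_def by blast+
    then show ?thesis by (auto simp: complex_is_Real_iff)
  qed
  have "Re (tensor_form f g t t) > 0"
    unfolding diag Re_sum using E(1) e val by (intro sum_pos2[OF E(1) e(1)]) auto
  moreover have "tensor_form f g t t \<in> \<real>" unfolding diag using val by (intro sum_in_Reals) blast
  ultimately show "tensor_form f g t t \<in> \<real> \<and> 0 < Re (tensor_form f g t t)" by blast
qed

text \<open>Different total degrees force different degrees in at least one factor, where
  \<open>f\<close> or \<open>g\<close> vanishes.\<close>

lemma tensor_form_orthogonal:
  assumes f: "\<And>\<alpha> \<beta> v v'. v \<in> GV \<alpha> \<Longrightarrow> v' \<in> GV \<beta> \<Longrightarrow> \<alpha> \<noteq> \<beta> \<Longrightarrow> f v v' = 0"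
    and g: "\<And>\<alpha> \<beta> w w'. w \<in> GW \<alpha> \<Longrightarrow> w' \<in> GW \<beta> \<Longrightarrow> \<alpha> \<noteq> \<beta> \<Longrightarrow> g w w' = 0"
    and "t \<in> tensor_grading GV GW \<gamma>" "u \<in> tensor_grading GV GW \<delta>" "\<gamma> \<noteq> \<delta>"
  shows "tensor_form f g t u = 0"
  using assms(3)
proof (induction rule: tensor_grading_induct)
  case (pure \<alpha> \<beta> v w)
  from assms(4) show ?case
  proof (induction rule: tensor_grading_induct)
    case (pure \<alpha>' \<beta>' v' w')
    then have "\<alpha> \<noteq> \<alpha>' \<or> \<beta> \<noteq> \<beta>'" using \<open>\<alpha> + \<beta> = \<gamma>\<close> \<open>\<gamma> \<noteq> \<delta>\<close> by blast
    then show ?case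
      using f[OF \<open>v \<in> GV \<alpha>\<close> pure(1)] g[OF \<open>w \<in> GW \<beta>\<close> pure(2)] by (auto simp: tensor_form_pure)
  qed (simp_all add: sesquilinear_zero[OF sesquilinear_tensor_form]
      sesquilinearD[OF sesquilinear_tensor_form])
qed (simp_all add: sesquilinear_zero[OF sesquilinear_tensor_form]
    sesquilinearD[OF sesquilinear_tensor_form])

end

section \<open>The action on the tensor product\<close>

context tensor_action_data
begin

text \<open>Additivity comes with the lift, homogeneity does not: the scalar is absorbed into the
  left factor of a pure tensor and pulled out again by \<open>block_scale\<close>.\<close>

lemma tensor_action_scale_left:
  "tensor_action \<omega> GB GV actV actW (k *\<^sub>C t) u = k *\<^sub>C tensor_action \<omega> GB GV actV actW t u"
proof (induction t rule: tensor_induct)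
  case (pure a b)
  show ?case
  proof (induction u rule: tensor_induct)
    case (pure v w)
    show ?case
      unfolding pure_tensor_scaleC_left[symmetric]
      unfolding tensor_action_def outer_pure
      unfolding inner_pure by (rule block_scale)
  next
    case (add u u')
    then show ?case by (simp add: tensor_action_add scaleC_add_right)
  qed
next
  case (add t t')
  then show ?case by (simp add: tensor_action_add scaleC_add_right)
qed

lemma tensor_action_scale_right:
  "tensor_action \<omega> GB GV actV actW t (k *\<^sub>C u) = k *\<^sub>C tensor_action \<omega> GB GV actV actW t u"
proof (induction t rule: tensor_induct)
  case (pure a b)
  show ?case
  proof (induction u rule: tensor_induct)
    case (pure v w)
    show ?case
      unfolding pure_tensor_scaleC_left[symmetric]
      unfolding tensor_action_def outer_pure
      unfolding inner_pure by (rule block_scale)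
  next
    case (add u u')
    then show ?case by (simp add: tensor_action_add scaleC_add_right)
  qed
next
  case (add t t')
  then show ?case by (simp add: tensor_action_add scaleC_add_right)
qed

lemma tensor_action_zero:
  "tensor_action \<omega> GB GV actV actW 0 u = 0" "tensor_action \<omega> GB GV actV actW t 0 = 0"
  using tensor_action_scale_left[of 0 0 u] tensor_action_scale_right[of t 0 0] by simp_all

end

lemma tensor_action_data_module:
  assumes "graded_module GA GV actV" "graded_module GA GW actW"
  shows "tensor_action_data GA GV actV actW"
proof -
  interpret V: graded_module GA GV actV by fact
  interpret W: graded_module GA GW actW by fact
  show ?thesis
    by unfold_locales
      (use V.act_linear W.act_linear in \<open>simp_all add: V.act_add_left W.act_add_left
        V.act_scaleC_left W.act_scaleC_left clinear_iff\<close>)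
qed

lemma tensor_action_data_mult:
  fixes GA :: "'g \<Rightarrow> 'a::complex_algebra_1 set" and GB :: "'g \<Rightarrow> 'b::complex_algebra_1 set"
  assumes "graded_space GA" "graded_space GB"
  shows "tensor_action_data GB GA ((*) :: 'a \<Rightarrow> _) ((*) :: 'b \<Rightarrow> _)"
  using assms
  by (intro tensor_action_data.intro tensor_action_data_axioms.intro)
    (simp_all add: algebra_simps mult_scaleC_left mult_scaleC_right)

text \<open>The twisted product is the left regular action, so all facts about
  \<open>tensor_action\<close> apply to it.\<close>

lemma tensor_mult_eq_action: "tensor_mult \<omega> GA GB = tensor_action \<omega> GB GA (*) (*)"
  unfolding tensor_mult_def tensor_action_def by (rule refl)

text \<open>The twisted expression behind the star is balanced because both involutions turn a
  scalar \<open>k\<close> into \<open>cnj k\<close>.\<close>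

lemma tensor_star_add:
  fixes \<omega> :: "'g::ab_group_add \<Rightarrow> 'g \<Rightarrow> complex"
  assumes "star_algebra GA starA" "star_algebra GB starB"
  shows "tensor_star \<omega> GA GB starA starB (t + u)
    = tensor_star \<omega> GA GB starA starB t + tensor_star \<omega> GA GB starA starB u"
proof -
  interpret A: star_algebra GA starA by fact
  interpret B: star_algebra GB starB by fact
  interpret twisted_extension GB GA \<omega> "\<lambda>b a. starA a \<otimes>\<^sub>t starB b"
    by unfold_locales
      (simp_all add: A.star_add B.star_add pure_tensor_add_left pure_tensor_add_right)
  have scale: "starA a \<otimes>\<^sub>t starB (k *\<^sub>C b) = cnj k *\<^sub>C (starA a \<otimes>\<^sub>t starB b)"
    "starA (k *\<^sub>C a) \<otimes>\<^sub>t starB b = cnj k *\<^sub>C (starA a \<otimes>\<^sub>t starB b)" for a b k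
    by (simp_all add: A.star_scaleC B.star_scaleC pure_tensor_scaleC_left pure_tensor_scaleC_right)
  interpret balanced "\<lambda>a b. twisted \<omega> GB GA (\<lambda>b a. starA a \<otimes>\<^sub>t starB b) b a"
    by unfold_locales
      (simp_all only: twisted_add_left twisted_add_right
        twisted_scale_left[OF scale(1)] twisted_scale_right[OF scale(2)])
  show ?thesis unfolding tensor_star_def by (rule tensor_lift_add)
qed

section \<open>Module axioms for the twisted action\<close>

context commutative_factor
begin

lemma factor_zero: "\<omega> 0 \<alpha> = 1" "\<omega> \<alpha> 0 = 1"
  using factor_add_left[of 0 0 \<alpha>] factor_add_right[of \<alpha> 0 0] factor_nonzero by simp_all

lemma factor_minus_left: "\<omega> (- \<alpha>) \<beta> = inverse (\<omega> \<alpha> \<beta>)"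
  using factor_add_left[of "- \<alpha>" \<alpha> \<beta>] factor_nonzero[of \<alpha> \<beta>]
  by (simp add: factor_zero field_simps)

text \<open>On homogeneous elements the left side carries \<open>\<omega> \<beta> \<alpha>' *
  \<omega> (\<beta> + \<beta>') \<nu>\<close> and the right side \<open>\<omega> \<beta>' \<nu> *
  \<omega> \<beta> (\<alpha>' + \<nu>)\<close>; these agree by multiplicativity in each
  argument.\<close>

lemma tensor_action_mult:
  assumes "graded_module GA GV actV" "graded_module GA GW actW"
  shows "tensor_action \<omega> GA GV actV actW (tensor_mult \<omega> GA GA t t') u
    = tensor_action \<omega> GA GV actV actW t (tensor_action \<omega> GA GV actV actW t' u)"
proof -
  interpret V: graded_module GA GV actV by fact
  interpret W: graded_module GA GW actW by fact
  interpret act: tensor_action_data GA GV \<omega> actV actW by (rule tensor_action_data_module) fact+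
  interpret mult: tensor_action_data GA GA \<omega> "(*)" "(*)"
    by (rule tensor_action_data_mult) unfold_locales
  note add = mult.tensor_action_add[folded tensor_mult_eq_action]
  note sp = V.graded_space_axioms V.module_space.graded_space_axioms W.module_space.graded_space_axioms
  show ?thesis
  proof (induction t rule: tensor_induct_homogeneous[OF sp(1) sp(1)])
    case (1 \<alpha> \<beta> a b)
    show ?case
    proof (induction t' rule: tensor_induct_homogeneous[OF sp(1) sp(1)])
      case (1 \<alpha>' \<beta>' a' b')
      show ?case
      proof (induction u rule: tensor_induct_homogeneous[OF sp(2) sp(3)])
        case (1 \<nu> \<mu> v w)
        have "b * b' \<in> GA (\<beta> + \<beta>')" "actV a' v \<in> GV (\<alpha>' + \<nu>)"
          using \<open>b \<in> GA \<beta>\<close> \<open>a' \<in> GA \<alpha>'\<close> \<open>b' \<in> GA \<beta>'\<close> 1 by (auto intro: V.mult_degree V.act_degree)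
        then show ?case
          using \<open>b \<in> GA \<beta>\<close> \<open>a' \<in> GA \<alpha>'\<close> \<open>b' \<in> GA \<beta>'\<close> 1
          by (simp add: tensor_mult_pure[OF sp(1) sp(1)] act.tensor_action_scale_left
              act.tensor_action_scale_right act.tensor_action_pure V.act_mult W.act_mult
              factor_add_left factor_add_right mult_ac)
      qed (simp add: act.tensor_action_add)
    qed (simp add: add act.tensor_action_add)
  qed (simp add: add act.tensor_action_add)
qed

lemma tensor_action_one:
  assumes "graded_module GA GV actV" "graded_module GA GW actW"
  shows "tensor_action \<omega> GA GV actV actW (1 \<otimes>\<^sub>t 1) u = u"
proof -
  interpret V: graded_module GA GV actV by fact
  interpret W: graded_module GA GW actW by fact
  interpret act: tensor_action_data GA GV \<omega> actV actW by (rule tensor_action_data_module) fact+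
  from V.module_space.graded_space_axioms W.module_space.graded_space_axioms show ?thesis
  proof (induction u rule: tensor_induct_homogeneous)
    case (pure \<nu> \<mu> v w)
    then show ?case
      by (simp add: act.tensor_action_pure[OF V.one_degree] factor_zero V.act_one W.act_one)
  qed (simp add: act.tensor_action_add)
qed

lemma tensor_action_degree:
  assumes "graded_module GA GV actV" "graded_module GA GW actW"
    and "t \<in> tensor_grading GA GA \<gamma>" "u \<in> tensor_grading GV GW \<delta>"
  shows "tensor_action \<omega> GA GV actV actW t u \<in> tensor_grading GV GW (\<gamma> + \<delta>)"
proof -
  interpret V: graded_module GA GV actV by fact
  interpret W: graded_module GA GW actW by fact
  interpret act: tensor_action_data GA GV \<omega> actV actW by (rule tensor_action_data_module) fact+
  note closed = cvec.subspace_0[OF subspace_tensor_grading] cvec.subspace_add[OF subspace_tensor_grading]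
    cvec.subspace_scale[OF subspace_tensor_grading]
  from assms(3) show ?thesis
  proof (induction rule: tensor_grading_induct)
    case (pure \<alpha> \<beta> a b)
    from assms(4) show ?case
    proof (induction rule: tensor_grading_induct)
      case (pure \<nu> \<mu> v w)
      \<comment> \<open>Commutativity of the grading group regroups the degrees by tensor
        factor.\<close>
      have "\<gamma> + \<delta> = (\<alpha> + \<nu>) + (\<beta> + \<mu>)"
        using \<open>\<alpha> + \<beta> = \<gamma>\<close> \<open>\<nu> + \<mu> = \<delta>\<close> by (auto simp: ac_simps)
      moreover have "actV a v \<otimes>\<^sub>t actW b w \<in> tensor_grading GV GW ((\<alpha> + \<nu>) + (\<beta> + \<mu>))"
        by (intro tensor_grading_pure V.act_degree W.act_degree) fact+
      ultimately show ?case
        using \<open>b \<in> GA \<beta>\<close> \<open>v \<in> GV \<nu>\<close> by (simp add: act.tensor_action_pure closed)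
    qed (simp_all add: act.tensor_action_zero act.tensor_action_add act.tensor_action_scale_right closed)
  qed (simp_all add: act.tensor_action_zero act.tensor_action_add act.tensor_action_scale_left closed)
qed

end

section \<open>Adjoints with respect to the product form\<close>

text \<open>A complex number of modulus one satisfies \<open>z * cnj z = 1\<close>. It is needed
  because the conjugate-linear first argument of the form conjugates the twist.\<close>

lemma (in unit_modulus_factor) cnj_factor: "cnj (\<omega> \<alpha> \<beta>) = inverse (\<omega> \<alpha> \<beta>)"
  using unit_modulus[of \<alpha> \<beta>] complex_norm_square[of "\<omega> \<alpha> \<beta>"]
  by (simp add: inverse_eq_divide divide_simps factor_nonzero mult.commute)

lemma (in unit_modulus_factor) tensor_form_adjoint:
  assumes V: "graded_module GA GV actV" and W: "graded_module GA GW actW" and "star_algebra GA star"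
    and "sesquilinear f" "sesquilinear g"
    and f_adj: "\<And>x v v'. f (actV x v) v' = f v (actV (star x) v')"
    and g_adj: "\<And>x w w'. g (actW x w) w' = g w (actW (star x) w')"
    and f_orth: "\<And>\<alpha> \<beta> v v'. v \<in> GV \<alpha> \<Longrightarrow> v' \<in> GV \<beta> \<Longrightarrow> \<alpha> \<noteq> \<beta> \<Longrightarrow> f v v' = 0"
  shows "tensor_form f g (tensor_action \<omega> GA GV actV actW t u) u'
    = tensor_form f g u (tensor_action \<omega> GA GV actV actW (tensor_star \<omega> GA GA star star t) u')"
proof -
  interpret V: graded_module GA GV actV by fact
  interpret W: graded_module GA GW actW by fact
  interpret star_algebra GA star by fact
  interpret act: tensor_action_data GA GV \<omega> actV actW by (rule tensor_action_data_module) fact+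
  interpret sesquilinear_pair f g by unfold_locales fact+
  note sp = V.graded_space_axioms V.module_space.graded_space_axioms W.module_space.graded_space_axioms
  note star_pure = tensor_star_pure[OF assms(3) assms(3)]
    and star_add = tensor_star_add[OF assms(3) assms(3)]
  note form_simps = tensor_form_add_left tensor_form_add_right tensor_form_scale_left tensor_form_scale_right
  show ?thesis
  proof (induction t rule: tensor_induct_homogeneous[OF sp(1) sp(1)])
    case (1 \<alpha> \<beta> a b)
    show ?case
    proof (induction u rule: tensor_induct_homogeneous[OF sp(2) sp(3)])
      case (1 \<nu> \<mu> v w)
      show ?case
      proof (induction u' rule: tensor_induct_homogeneous[OF sp(2) sp(3)])
        case (1 \<nu>' \<mu>' v' w')
        have star_b: "star b \<in> GA (- \<beta>)" using star_degree[of \<beta>] \<open>b \<in> GA \<beta>\<close> by blast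
        have "tensor_form f g (tensor_action \<omega> GA GV actV actW (a \<otimes>\<^sub>t b) (v \<otimes>\<^sub>t w)) (v' \<otimes>\<^sub>t w')
            = inverse (\<omega> \<beta> \<nu>) * (f (actV a v) v' * g (actW b w) w')"
          using \<open>b \<in> GA \<beta>\<close> \<open>v \<in> GV \<nu>\<close>
          by (simp add: act.tensor_action_pure form_simps tensor_form_pure cnj_factor)
        \<comment> \<open>If \<open>\<nu>' = \<alpha> + \<nu>\<close>, then
          \<open>\<omega> \<beta> \<nu>'\<close> splits and the scalars agree; otherwise the value
          of \<open>f\<close> is zero and the scalars do not matter.\<close>
        also have "\<dots> = \<omega> \<beta> \<alpha> * inverse (\<omega> \<beta> \<nu>') * (f (actV a v) v' * g (actW b w) w')"
        proof (cases "\<nu>' = \<alpha> + \<nu>")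
          case True
          then show ?thesis using factor_nonzero[of \<beta> \<alpha>] by (simp add: factor_add_right)
        next
          case False
          then have "f (actV a v) v' = 0"
            using f_orth[OF V.act_degree] \<open>a \<in> GA \<alpha>\<close> \<open>v \<in> GV \<nu>\<close> 1 by metis
          then show ?thesis by simp
        qed
        \<comment> \<open>The star contributes \<open>\<omega> \<beta> \<alpha>\<close>; moving
          \<open>star b\<close>, of degree \<open>- \<beta>\<close>, past \<open>v'\<close>
          contributes \<open>inverse (\<omega> \<beta> \<nu>')\<close>.\<close>
        also have "\<dots> = tensor_form f g (v \<otimes>\<^sub>t w)
            (tensor_action \<omega> GA GV actV actW (tensor_star \<omega> GA GA star star (a \<otimes>\<^sub>t b)) (v' \<otimes>\<^sub>t w'))"
          using \<open>a \<in> GA \<alpha>\<close> \<open>b \<in> GA \<beta>\<close> 1 star_b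
          by (simp add: star_pure act.tensor_action_scale_left act.tensor_action_pure form_simps
              tensor_form_pure f_adj g_adj factor_minus_left)
        finally show ?case .
      qed (simp add: act.tensor_action_add form_simps)
    qed (simp add: act.tensor_action_add form_simps)
  qed (simp add: act.tensor_action_add star_add form_simps)
qed

section \<open>Unitarisability of the tensor product module\<close>

theorem theorem5p15:
  fixes \<omega> :: "'g::ab_group_add \<Rightarrow> 'g \<Rightarrow> complex"
    and GA :: "'g \<Rightarrow> 'a::complex_algebra_1 set"
    and GV :: "'g \<Rightarrow> 'v::complex_vector set" and GW :: "'g \<Rightarrow> 'w::complex_vector set"
  assumes "hopf_star_algebra \<omega> GA \<Delta> \<epsilon> S star"
    and "unitarisable_graded_module GA star GV actV"
    and "unitarisable_graded_module GA star GW actW"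
  shows "unitarisable_graded_module GA star (tensor_grading GV GW)
    (\<lambda>x. tensor_action \<omega> GA GV actV actW (\<Delta> x))"
proof -
  interpret hopf_star_algebra \<omega> GA \<Delta> \<epsilon> S star by fact
  obtain f where V: "graded_module GA GV actV" and f: "sesquilinear f" "positive_definite f"
    and f_adj: "\<And>x v v'. f (actV x v) v' = f v (actV (star x) v')"
    and f_orth: "\<And>\<alpha> \<beta> v v'. v \<in> GV \<alpha> \<Longrightarrow> v' \<in> GV \<beta> \<Longrightarrow> \<alpha> \<noteq> \<beta> \<Longrightarrow> f v v' = 0"
    using assms(2) unfolding unitarisable_graded_module_def by blast
  obtain g where W: "graded_module GA GW actW" and g: "sesquilinear g" "positive_definite g"
    and g_adj: "\<And>x w w'. g (actW x w) w' = g w (actW (star x) w')"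
    and g_orth: "\<And>\<alpha> \<beta> w w'. w \<in> GW \<alpha> \<Longrightarrow> w' \<in> GW \<beta> \<Longrightarrow> \<alpha> \<noteq> \<beta> \<Longrightarrow> g w w' = 0"
    using assms(3) unfolding unitarisable_graded_module_def by blast
  interpret V: graded_module GA GV actV by (rule V)
  interpret W: graded_module GA GW actW by (rule W)
  interpret act: tensor_action_data GA GV \<omega> actV actW by (rule tensor_action_data_module[OF V W])
  interpret sesquilinear_pair f g by unfold_locales (rule f g)+
  note form = sesquilinear_tensor_form positive_definite_tensor_form[OF f(2) g(2)]
  have orth: "tensor_form f g t u = 0"
    if "t \<in> tensor_grading GV GW \<gamma>" "u \<in> tensor_grading GV GW \<delta>" "\<gamma> \<noteq> \<delta>" for t u \<gamma> \<delta>
    by (rule tensor_form_orthogonal[OF _ _ that]) (fact f_orth g_orth)+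
  \<comment> \<open>The form precedes the module structure, since its orthogonality is what makes
    the tensor grading a direct sum.\<close>
  interpret tensor: graded_space "tensor_grading GV GW"
    by (rule graded_space_orthogonal[OF _ form])
      (fact subspace_tensor_grading orth tensor_grading_decomposition[OF
        V.module_space.graded_space_axioms W.module_space.graded_space_axioms])+
  \<comment> \<open>The module axioms are pulled back from the action of the twisted tensor square
    along \<Delta>, a unital algebra homomorphism of degree zero.\<close>
  have module: "graded_module GA (tensor_grading GV GW) (\<lambda>x. tensor_action \<omega> GA GV actV actW (\<Delta> x))"
  proof (intro graded_module.intro graded_module_axioms.intro graded_algebra_axioms
      tensor.graded_space_axioms)
    show "clinear (tensor_action \<omega> GA GV actV actW (\<Delta> x))" for x
      by (simp add: clinear_iff act.tensor_action_add act.tensor_action_scale_right)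
    show "tensor_action \<omega> GA GV actV actW (\<Delta> (x * y)) u
        = tensor_action \<omega> GA GV actV actW (\<Delta> x) (tensor_action \<omega> GA GV actV actW (\<Delta> y) u)" for x y u
      unfolding comult.hom_mult by (rule tensor_action_mult[OF V W])
    show "tensor_action \<omega> GA GV actV actW (\<Delta> 1) u = u" for u
      unfolding comult.hom_one by (rule tensor_action_one[OF V W])
    show "tensor_action \<omega> GA GV actV actW (\<Delta> x) u \<in> tensor_grading GV GW (\<alpha> + \<beta>)"
      if "x \<in> GA \<alpha>" "u \<in> tensor_grading GV GW \<beta>" for x u \<alpha> \<beta>
      by (rule tensor_action_degree[OF V W comult.hom_degree[OF that(1)] that(2)])
    have comult_add: "\<Delta> (x + y) = \<Delta> x + \<Delta> y" and comult_scale: "\<Delta> (c *\<^sub>C x) = c *\<^sub>C \<Delta> x" for x y c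
      using comult.hom_linear unfolding clinear_iff by blast+
    show "tensor_action \<omega> GA GV actV actW (\<Delta> (x + y)) u
        = tensor_action \<omega> GA GV actV actW (\<Delta> x) u + tensor_action \<omega> GA GV actV actW (\<Delta> y) u" for x y u
      unfolding comult_add by (rule act.tensor_action_add)
    show "tensor_action \<omega> GA GV actV actW (\<Delta> (c *\<^sub>C x)) u
        = c *\<^sub>C tensor_action \<omega> GA GV actV actW (\<Delta> x) u" for c x u
      unfolding comult_scale by (rule act.tensor_action_scale_left)
  qed
  \<comment> \<open>Since \<Delta> commutes with the stars, adjointness reduces to that of the
    tensor square.\<close>
  have adjoint: "tensor_form f g (tensor_action \<omega> GA GV actV actW (\<Delta> x) u) u'
      = tensor_form f g u (tensor_action \<omega> GA GV actV actW (\<Delta> (star x)) u')" for x u u'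
    unfolding comult_star
    by (rule tensor_form_adjoint[OF V W star_algebra_axioms f(1) g(1)]) (fact f_adj g_adj f_orth)+
  show ?thesis
    unfolding unitarisable_graded_module_def
  proof (intro conjI exI[of _ "tensor_form f g"])
    show "\<forall>x v v'. tensor_form f g (tensor_action \<omega> GA GV actV actW (\<Delta> x) v) v'
        = tensor_form f g v (tensor_action \<omega> GA GV actV actW (\<Delta> (star x)) v')"
      by (intro allI adjoint)
    show "\<forall>\<alpha> \<beta>. \<forall>v\<in>tensor_grading GV GW \<alpha>. \<forall>v'\<in>tensor_grading GV GW \<beta>.
        \<alpha> \<noteq> \<beta> \<longrightarrow> tensor_form f g v v' = 0"
      by (intro allI ballI impI) (rule orth)
  qed (rule module form)+
qed

end
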